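(* Let $(A, H, \triangleright, \triangleleft)$ be a matched pair of Hopf algebras over $k$, $H'$ a Hopf algebra and $(A, \triangleright')$ a left $H'$-module algebra and left $H'$-module coalgebra satisfying $g_{(1)} \otimes g_{(2)} \triangleright' a = g_{(2)} \otimes g_{(1)} \triangleright' a$ for all $g \in H'$, $a \in A$. The following are equivalent: (1) There exists a left $A$-linear Hopf algebra isomorphism $A \bowtie H \cong A \#' H'$. (2) The right action $\triangleleft$ is the trivial action and there exists a pair $(r, v)$, where $r: H \to A$ is a unitary cocentral map and $v: H \to H'$ is an isomorphism of Hopf algebras, such that the left action $\triangleright$ is implemented by the formula $$h \triangleright a = r (h_{(1)}) \, \bigl(v(h_{(2)}) \triangleright' a \bigr) \, (S_A \circ r) (h_{(3)})$$ and the following compatibility condition holds: $$r(hg) = r(h_{(1)})\bigl(v(h_{(2)}) \triangleright' r(g)\bigr)$$ for all $h, g\in H$ and $a\in A$.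
   Context: $k$ is a field; all algebras, coalgebras, Hopf algebras, tensor products and homomorphisms are over $k$. Sweedler notation is used; $S_A$ is the antipode of $A$. A map $f$ between Hopf algebras is unitary if $f(1)=1$. A coalgebra map $r: H \to A$ is cocentral if $r(h_{(1)}) \otimes h_{(2)} = r(h_{(2)}) \otimes h_{(1)}$ for all $h \in H$. The right action $\triangleleft$ is trivial if $h \triangleleft a = \varepsilon_A(a) h$ for all $a\in A$, $h\in H$. A matched pair of Hopf algebras is a system $(A, H, \triangleleft, \triangleright)$ (also written $(A,H,\triangleright,\triangleleft)$) where $\triangleleft : H \otimes A \to H$, $\triangleright: H \otimes A \to A$ are coalgebra maps such that $(A, \triangleright)$ is a left $H$-module, $(H, \triangleleft)$ is a right $A$-module, and for all $a, b \in A$, $g, h \in H$: $h \triangleright 1_A = \varepsilon_H(h) 1_A$, $1_H \triangleleft a = \varepsilon_A(a) 1_H$; $g \triangleright (ab) = (g_{(1)} \triangleright a_{(1)}) \bigl( (g_{(2)} \triangleleft a_{(2)}) \triangleright b \bigr)$; $(gh) \triangleleft a = \bigl( g \triangleleft (h_{(1)} \triangleright a_{(1)}) \bigr)(h_{(2)} \triangleleft a_{(2)})$; $g_{(1)} \triangleleft a_{(1)} \otimes g_{(2)} \triangleright a_{(2)} = g_{(2)} \triangleleft a_{(2)} \otimes g_{(1)} \triangleright a_{(1)}$. The bicrossed product $A \bowtie H$ is $A \otimes H$ (with $a \bowtie h := a \otimes h$) with unit $1_A \bowtie 1_H$, multiplication $(a \bowtie h)(c \bowtie g) = a (h_{(1)}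 \triangleright c_{(1)}) \bowtie (h_{(2)} \triangleleft c_{(2)}) g$ and the tensor product coalgebra structure; it is a Hopf algebra. $(A, \triangleright')$ is a left $H'$-module coalgebra if $\triangleright' : H' \otimes A \to A$ is a module action that is a coalgebra map. The semi-direct (smash) product $A \#' H'$ is the Hopf algebra on $A \otimes H'$ with multiplication $(a \#' h)(c \#' g) = a (h_{(1)} \triangleright' c) \#' h_{(2)} g$, unit $1_A \#' 1_{H'}$ and the tensor product coalgebra structure. $A \bowtie H$ and $A \#' H'$ are left $A$-modules by left multiplication through the inclusions $a \mapsto a \bowtie 1_H$, $a \mapsto a \#' 1_{H'}$. *)

theory Defs
  imports Complex_Main "HOL-Library.Function_Algebras"
begin

section \<open>Vector spaces and tensor products over a field\<close>

text \<open>
  A vector space over the field \<open>'k\<close> is a subspace \<open>carrier V\<close> (possibly everything) of an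
  ambient type with scalar multiplication \<open>scale V\<close>.  Maps between vector spaces are
  functions on the ambient types of which only the values on the carriers matter.
\<close>

record ('k, 'v) vspace =
  carrier :: "'v set"
  scale :: "'k \<Rightarrow> 'v \<Rightarrow> 'v"  (infixr "\<odot>\<index>" 80)

locale vspace =
  fixes V :: "('k::field, 'v::ab_group_add, 'm) vspace_scheme" (structure)
  assumes vector_space_scale: "vector_space (scale V)"
    and subspace_carrier: "module.subspace (scale V) (carrier V)"

definition ground :: "('k::field, 'k) vspace" where
  "ground = \<lparr>carrier = UNIV, scale = (*)\<rparr>"

definition linear_map ::
  "('k::field, 'v::ab_group_add, 'm) vspace_scheme \<Rightarrow> ('k, 'w::ab_group_add, 'n) vspace_scheme
    \<Rightarrow> ('v \<Rightarrow> 'w) \<Rightarrow> bool" where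
  "linear_map V W f \<longleftrightarrow>
     (\<forall>x\<in>carrier V. f x \<in> carrier W) \<and>
     (\<forall>x\<in>carrier V. \<forall>y\<in>carrier V. f (x + y) = f x + f y) \<and>
     (\<forall>c. \<forall>x\<in>carrier V. f (c \<odot>\<^bsub>V\<^esub> x) = c \<odot>\<^bsub>W\<^esub> f x)"

definition bilinear_map ::
  "('k::field, 'v::ab_group_add, 'm) vspace_scheme \<Rightarrow> ('k, 'w::ab_group_add, 'n) vspace_scheme
    \<Rightarrow> ('k, 'x::ab_group_add, 'l) vspace_scheme \<Rightarrow> ('v \<Rightarrow> 'w \<Rightarrow> 'x) \<Rightarrow> bool" where
  "bilinear_map V W X f \<longleftrightarrow>
     (\<forall>x\<in>carrier V. linear_map W X (f x)) \<and>
     (\<forall>y\<in>carrier W. linear_map V X (\<lambda>x. f x y))"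

text \<open>
  The tensor product is realised inside the dual of the space of bilinear forms: \<open>v \<otimes> w\<close> is
  evaluation of forms at \<open>(v, w)\<close>, and \<open>tensor V W\<close> is the span of these.  Over a field this is
  a tensor product; see the universal property in \<open>tensor_universal\<close> and \<open>tensor_unique\<close> below.
\<close>

type_synonym ('k, 'v, 'w) tensor = "('v \<Rightarrow> 'w \<Rightarrow> 'k) \<Rightarrow> 'k"

definition pure_tensor ::
  "'v::ab_group_add \<Rightarrow> ('k::field, 'v, 'm) vspace_scheme
    \<Rightarrow> ('k, 'w::ab_group_add, 'n) vspace_scheme \<Rightarrow> 'w \<Rightarrow> ('k, 'v, 'w) tensor"
  ("(_/ \<otimes>\<^bsub>_,_\<^esub> _)" [71, 0, 0, 71] 70) where
  "v \<otimes>\<^bsub>V,W\<^esub> w = (\<lambda>\<beta>. if bilinear_map V W ground \<beta> then \<beta> v w else 0)"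

definition tensor_scale :: "'k::field \<Rightarrow> ('k, 'v, 'w) tensor \<Rightarrow> ('k, 'v, 'w) tensor" where
  "tensor_scale c t = (\<lambda>\<beta>. c * t \<beta>)"

definition tensor ::
  "('k::field, 'v::ab_group_add, 'm) vspace_scheme \<Rightarrow> ('k, 'w::ab_group_add, 'n) vspace_scheme
    \<Rightarrow> ('k, ('k, 'v, 'w) tensor) vspace" where
  "tensor V W =
     \<lparr>carrier = module.span tensor_scale {v \<otimes>\<^bsub>V,W\<^esub> w | v w. v \<in> carrier V \<and> w \<in> carrier W},
      scale = tensor_scale\<rparr>"

text \<open>
  Sweedler notation: \<open>tensor_rep V W t\<close> is some list of pairs \<open>(v, w)\<close> with
  \<open>t = \<Sum> v \<otimes> w\<close>.  Sums of the form \<open>\<Sum>(v, w)\<leftarrow>tensor_rep V W t. f v w\<close> do not depend on the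
  choice whenever \<open>f\<close> is bilinear, which is the case in every use below.
\<close>

definition tensor_rep ::
  "('k::field, 'v::ab_group_add, 'm) vspace_scheme \<Rightarrow> ('k, 'w::ab_group_add, 'n) vspace_scheme
    \<Rightarrow> ('k, 'v, 'w) tensor \<Rightarrow> ('v \<times> 'w) list" where
  "tensor_rep V W t =
     (SOME ps. set ps \<subseteq> carrier V \<times> carrier W \<and> t = (\<Sum>(v, w)\<leftarrow>ps. v \<otimes>\<^bsub>V,W\<^esub> w))"

lemma vector_space_tensor_scale:
  "vector_space (tensor_scale :: 'k::field \<Rightarrow> ('k, 'v, 'w) tensor \<Rightarrow> _)"
  by unfold_locales (auto simp: tensor_scale_def plus_fun_def zero_fun_def fun_eq_iff algebra_simps)

lemma module_tensor_scale:
  "module (tensor_scale :: 'k::field \<Rightarrow> ('k, 'v, 'w) tensor \<Rightarrow> _)"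
  using vector_space_tensor_scale by (simp add: vector_space_def module_def)

lemma vspace_tensor: "vspace (tensor V W)"
  unfolding vspace_def tensor_def
  by (simp add: vector_space_tensor_scale module.subspace_span[OF module_tensor_scale])

context vspace
begin

sublocale vs: vector_space "scale V" by (rule vector_space_scale)

lemma zero_closed: "0 \<in> carrier V"
  and add_closed: "x \<in> carrier V \<Longrightarrow> y \<in> carrier V \<Longrightarrow> x + y \<in> carrier V"
  and scale_closed: "x \<in> carrier V \<Longrightarrow> c \<odot> x \<in> carrier V"
  using subspace_carrier by (auto simp: vs.subspace_def)

lemma separating_functional:
  assumes "z \<noteq> 0"
  obtains g where "linear_map V ground g" "g z = 1"
    "\<And>x y. g (x + y) = g x + g y"
proof -
  define B where "B = vs.extend_basis {z}"
  have ind: "vs.independent {z}" using assms by simp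
  have B: "vs.independent B" "vs.span B = UNIV" "z \<in> B"
    using vs.independent_extend_basis[OF ind] vs.span_extend_basis[OF ind]
      vs.extend_basis_superset[OF ind] by (auto simp: B_def)
  define g where "g = (\<lambda>v. vs.representation B v z)"
  have add: "g (x + y) = g x + g y" for x y
    using vs.representation_add[OF B(1), of y x] B(2) by (simp add: g_def add.commute)
  have "linear_map V ground g"
    using add vs.representation_scale[OF B(1)] B(2)
    by (auto simp: linear_map_def ground_def g_def)
  moreover have "g z = 1"
    using vs.representation_basis[OF B(1) B(3)] by (simp add: g_def)
  ultimately show ?thesis using that add by blast
qed

end

lemma tensor_rep_exists:
  fixes V :: "('k::field, 'v::ab_group_add, 'm) vspace_scheme"
    and W :: "('k, 'w::ab_group_add, 'n) vspace_scheme"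
  assumes "vspace V" "vspace W" "t \<in> carrier (tensor V W)"
  shows "\<exists>ps. set ps \<subseteq> carrier V \<times> carrier W \<and> t = (\<Sum>(v, w)\<leftarrow>ps. v \<otimes>\<^bsub>V,W\<^esub> w)"
proof -
  interpret V: vspace V by fact
  interpret T: vector_space "tensor_scale :: 'k \<Rightarrow> ('k, 'v, 'w) tensor \<Rightarrow> _"
    by (rule vector_space_tensor_scale)
  let ?P = "{t. \<exists>ps. set ps \<subseteq> carrier V \<times> carrier W \<and> t = (\<Sum>(v, w)\<leftarrow>ps. v \<otimes>\<^bsub>V,W\<^esub> w)}"
  have pure: "v \<otimes>\<^bsub>V,W\<^esub> w \<in> ?P" if "v \<in> carrier V" "w \<in> carrier W" for v w
    by (rule CollectI, rule exI[of _ "[(v, w)]"]) (use that in simp)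
  have sc: "tensor_scale c (\<Sum>(v, w)\<leftarrow>ps. v \<otimes>\<^bsub>V,W\<^esub> w)
      = (\<Sum>(v, w)\<leftarrow>map (\<lambda>(v, w). (c \<odot>\<^bsub>V\<^esub> v, w)) ps. v \<otimes>\<^bsub>V,W\<^esub> w)"
    if "set ps \<subseteq> carrier V \<times> carrier W" for c ps
    using that
  proof (induction ps)
    case Nil
    show ?case using T.scale_zero_right by (simp only: list.map sum_list.Nil)
  next
    case (Cons p ps)
    obtain v w where p: "p = (v, w)" by fastforce
    have "tensor_scale c (v \<otimes>\<^bsub>V,W\<^esub> w) = (c \<odot>\<^bsub>V\<^esub> v) \<otimes>\<^bsub>V,W\<^esub> w"
      using Cons.prems p
      by (auto simp: tensor_scale_def pure_tensor_def plus_fun_def fun_eq_iff bilinear_map_def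
          linear_map_def ground_def)
    moreover have "set ps \<subseteq> carrier V \<times> carrier W" using Cons.prems by simp
    ultimately show ?case
      by (simp only: p list.map sum_list.Cons prod.case T.scale_right_distrib Cons.IH)
  qed
  have "T.subspace ?P"
    unfolding T.subspace_def
  proof (intro conjI ballI allI)
    show "0 \<in> ?P" by (rule CollectI, rule exI[of _ "[]"]) simp
  next
    fix x y assume "x \<in> ?P" "y \<in> ?P"
    then obtain ps qs where
      "set ps \<subseteq> carrier V \<times> carrier W" "x = (\<Sum>(v, w)\<leftarrow>ps. v \<otimes>\<^bsub>V,W\<^esub> w)"
      "set qs \<subseteq> carrier V \<times> carrier W" "y = (\<Sum>(v, w)\<leftarrow>qs. v \<otimes>\<^bsub>V,W\<^esub> w)" by blast
    then show "x + y \<in> ?P"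
      by (intro CollectI exI[of _ "ps @ qs"]) simp
  next
    fix c x assume "x \<in> ?P"
    then obtain ps where
      ps: "set ps \<subseteq> carrier V \<times> carrier W" "x = (\<Sum>(v, w)\<leftarrow>ps. v \<otimes>\<^bsub>V,W\<^esub> w)" by blast
    then show "tensor_scale c x \<in> ?P"
      using sc[OF ps(1), of c] V.scale_closed
      by (intro CollectI exI[of _ "map (\<lambda>(v, w). (c \<odot>\<^bsub>V\<^esub> v, w)) ps"]) auto
  qed
  moreover have "{v \<otimes>\<^bsub>V,W\<^esub> w | v w. v \<in> carrier V \<and> w \<in> carrier W} \<subseteq> ?P"
    using pure by blast
  ultimately have "carrier (tensor V W) \<subseteq> ?P"
    unfolding tensor_def vspace.simps by (intro T.span_minimal)
  then show ?thesis using assms(3) by blast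
qed

lemma tensor_rep:
  assumes "vspace V" "vspace W" "t \<in> carrier (tensor V W)"
  shows "set (tensor_rep V W t) \<subseteq> carrier V \<times> carrier W"
    and "(\<Sum>(v, w)\<leftarrow>tensor_rep V W t. v \<otimes>\<^bsub>V,W\<^esub> w) = t"
  using someI_ex[OF tensor_rep_exists[OF assms]] by (simp_all add: tensor_rep_def)

lemma pure_tensor_closed:
  assumes "v \<in> carrier V" "w \<in> carrier W"
  shows "v \<otimes>\<^bsub>V,W\<^esub> w \<in> carrier (tensor V W)"
  unfolding tensor_def using assms
  by (auto intro!: module.span_base[OF module_tensor_scale])

lemma bilinear_pure_tensor: "bilinear_map V W (tensor V W) (\<lambda>v w. v \<otimes>\<^bsub>V,W\<^esub> w)"
  by (auto simp: bilinear_map_def linear_map_def pure_tensor_closed)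
     (auto simp: bilinear_map_def linear_map_def pure_tensor_def plus_fun_def fun_eq_iff tensor_def
        tensor_scale_def ground_def)

lemma tensor_sum_eqI:
  assumes X: "vspace X" and f: "bilinear_map V W X f"
    and ps: "set ps \<subseteq> carrier V \<times> carrier W" and qs: "set qs \<subseteq> carrier V \<times> carrier W"
    and eq: "(\<Sum>(v, w)\<leftarrow>ps. v \<otimes>\<^bsub>V,W\<^esub> w) = (\<Sum>(v, w)\<leftarrow>qs. v \<otimes>\<^bsub>V,W\<^esub> w)"
  shows "(\<Sum>(v, w)\<leftarrow>ps. f v w) = (\<Sum>(v, w)\<leftarrow>qs. f v w)"
proof (rule ccontr)
  interpret X: vspace X by fact
  assume "\<not> ?thesis"
  then have "(\<Sum>(v, w)\<leftarrow>ps. f v w) - (\<Sum>(v, w)\<leftarrow>qs. f v w) \<noteq> 0" by simp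
  then obtain g where g: "linear_map X ground g" and add: "\<And>x y. g (x + y) = g x + g y"
    and g1: "g ((\<Sum>(v, w)\<leftarrow>ps. f v w) - (\<Sum>(v, w)\<leftarrow>qs. f v w)) = 1"
    using X.separating_functional by metis
  have zero: "g 0 = 0" using add[of 0 0] unfolding add_0_right by (metis add_cancel_right_right)
  have diff: "g (x - y) = g x - g y" for x y using add[of "x - y" y] by (simp add: algebra_simps)
  have bil: "bilinear_map V W ground (\<lambda>v w. g (f v w))"
    using f g unfolding bilinear_map_def linear_map_def by (auto simp: ground_def)
  have ev: "(\<Sum>(v, w)\<leftarrow>rs. v \<otimes>\<^bsub>V,W\<^esub> w) (\<lambda>v w. g (f v w)) = g (\<Sum>(v, w)\<leftarrow>rs. f v w)" for rs
    by (induction rs) (auto simp: zero add pure_tensor_def plus_fun_def zero_fun_def bil)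
  show False using g1 ev[of ps] ev[of qs] eq by (simp add: diff)
qed

lemma tensor_rep_sum:
  assumes "vspace V" "vspace W" "vspace X" "bilinear_map V W X f"
    and "set ps \<subseteq> carrier V \<times> carrier W"
  shows "(\<Sum>(v, w)\<leftarrow>tensor_rep V W (\<Sum>(v, w)\<leftarrow>ps. v \<otimes>\<^bsub>V,W\<^esub> w). f v w) = (\<Sum>(v, w)\<leftarrow>ps. f v w)"
proof -
  interpret T: vspace "tensor V W" by (rule vspace_tensor)
  have "(\<Sum>(v, w)\<leftarrow>ps. v \<otimes>\<^bsub>V,W\<^esub> w) \<in> carrier (tensor V W)"
    using assms(5) by (induction ps) (auto simp: T.zero_closed T.add_closed pure_tensor_closed)
  from tensor_rep[OF assms(1,2) this] show ?thesis
    using tensor_sum_eqI[OF assms(3,4) _ assms(5)] by simp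
qed

theorem tensor_universal:
  assumes V: "vspace V" and W: "vspace W" and X: "vspace X" and f: "bilinear_map V W X f"
  shows "linear_map (tensor V W) X (\<lambda>t. \<Sum>(v, w)\<leftarrow>tensor_rep V W t. f v w)" (is "linear_map _ _ ?F")
    and "v \<in> carrier V \<Longrightarrow> w \<in> carrier W
      \<Longrightarrow> (\<Sum>(v, w)\<leftarrow>tensor_rep V W (v \<otimes>\<^bsub>V,W\<^esub> w). f v w) = f v w"
proof -
  interpret V: vspace V by fact
  interpret X: vspace X by fact
  interpret T: vspace "tensor V W" by (rule vspace_tensor)
  note rep = tensor_rep[OF V W] and rep_sum = tensor_rep_sum[OF V W X f]
  have closed: "(\<Sum>(v, w)\<leftarrow>ps. f v w) \<in> carrier X" if "set ps \<subseteq> carrier V \<times> carrier W" for ps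
    using that f
    by (induction ps) (auto simp: X.zero_closed X.add_closed bilinear_map_def linear_map_def)
  show "linear_map (tensor V W) X ?F"
    unfolding linear_map_def
  proof (intro conjI ballI allI)
    fix x assume "x \<in> carrier (tensor V W)"
    then show "?F x \<in> carrier X" using rep(1) closed by blast
  next
    fix x y assume x: "x \<in> carrier (tensor V W)" and y: "y \<in> carrier (tensor V W)"
    have "x + y = (\<Sum>(v, w)\<leftarrow>tensor_rep V W x @ tensor_rep V W y. v \<otimes>\<^bsub>V,W\<^esub> w)"
      using rep(2)[OF x] rep(2)[OF y] by simp
    then show "?F (x + y) = ?F x + ?F y"
      using rep_sum[of "tensor_rep V W x @ tensor_rep V W y"] rep(1)[OF x] rep(1)[OF y] by simp
  next
    fix c x assume x: "x \<in> carrier (tensor V W)"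
    let ?ps = "tensor_rep V W x"
    let ?qs = "map (\<lambda>(v, w). (c \<odot>\<^bsub>V\<^esub> v, w)) ?ps"
    have "c \<odot>\<^bsub>tensor V W\<^esub> (\<Sum>(v, w)\<leftarrow>ps. v \<otimes>\<^bsub>V,W\<^esub> w)
          = (\<Sum>(v, w)\<leftarrow>map (\<lambda>(v, w). (c \<odot>\<^bsub>V\<^esub> v, w)) ps. v \<otimes>\<^bsub>V,W\<^esub> w)
       \<and> c \<odot>\<^bsub>X\<^esub> (\<Sum>(v, w)\<leftarrow>ps. f v w)
          = (\<Sum>(v, w)\<leftarrow>map (\<lambda>(v, w). (c \<odot>\<^bsub>V\<^esub> v, w)) ps. f v w)"
      if "set ps \<subseteq> carrier V \<times> carrier W" for ps
      using that
    proof (induction ps)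
      case Nil
      show ?case
        by (simp only: list.map sum_list.Nil simp_thms X.vs.scale_zero_right T.vs.scale_zero_right)
    next
      case (Cons p ps)
      obtain v w where p: "p = (v, w)" by fastforce
      have "c \<odot>\<^bsub>tensor V W\<^esub> (v \<otimes>\<^bsub>V,W\<^esub> w) = (c \<odot>\<^bsub>V\<^esub> v) \<otimes>\<^bsub>V,W\<^esub> w" "c \<odot>\<^bsub>X\<^esub> f v w = f (c \<odot>\<^bsub>V\<^esub> v) w"
        using Cons.prems p bilinear_pure_tensor[of V W] f
        by (auto simp: bilinear_map_def linear_map_def)
      moreover have "set ps \<subseteq> carrier V \<times> carrier W" using Cons.prems by simp
      ultimately show ?case
        by (simp only: p list.map sum_list.Cons prod.case X.vs.scale_right_distrib
            T.vs.scale_right_distrib Cons.IH simp_thms)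
    qed
    note * = this[OF rep(1)[OF x]]
    have qs: "set ?qs \<subseteq> carrier V \<times> carrier W"
      using rep(1)[OF x] V.scale_closed by auto
    show "?F (c \<odot>\<^bsub>tensor V W\<^esub> x) = c \<odot>\<^bsub>X\<^esub> ?F x"
      using * rep_sum[OF qs] rep(2)[OF x] by simp
  qed
  show "?F (v \<otimes>\<^bsub>V,W\<^esub> w) = f v w" if "v \<in> carrier V" "w \<in> carrier W"
    using rep_sum[of "[(v, w)]"] that by simp
qed

theorem tensor_unique:
  assumes V: "vspace V" and W: "vspace W" and X: "vspace X"
    and F: "linear_map (tensor V W) X F" and G: "linear_map (tensor V W) X G"
    and eq: "\<And>v w. v \<in> carrier V \<Longrightarrow> w \<in> carrier W \<Longrightarrow> F (v \<otimes>\<^bsub>V,W\<^esub> w) = G (v \<otimes>\<^bsub>V,W\<^esub> w)"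
    and t: "t \<in> carrier (tensor V W)"
  shows "F t = G t"
proof -
  interpret T: vspace "tensor V W" by (rule vspace_tensor)
  have z: "H 0 = 0" if "linear_map (tensor V W) X H" for H
  proof -
    have "H (0 + 0) = H 0 + H 0" using that T.zero_closed unfolding linear_map_def by blast
    then show ?thesis by simp
  qed
  have "(\<Sum>(v, w)\<leftarrow>ps. v \<otimes>\<^bsub>V,W\<^esub> w) \<in> carrier (tensor V W) \<and>
      F (\<Sum>(v, w)\<leftarrow>ps. v \<otimes>\<^bsub>V,W\<^esub> w) = G (\<Sum>(v, w)\<leftarrow>ps. v \<otimes>\<^bsub>V,W\<^esub> w)"
    if "set ps \<subseteq> carrier V \<times> carrier W" for ps
    using that
  proof (induction ps)
    case Nil
    show ?case using z[OF F] z[OF G] T.zero_closed by (simp only: list.map sum_list.Nil)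
  next
    case (Cons p ps)
    obtain v w where p: "p = (v, w)" by fastforce
    let ?s = "\<Sum>(v, w)\<leftarrow>ps. v \<otimes>\<^bsub>V,W\<^esub> w"
    have vw: "v \<in> carrier V" "w \<in> carrier W" using Cons.prems p by auto
    have s: "?s \<in> carrier (tensor V W)" "F ?s = G ?s" using Cons by auto
    note vw' = pure_tensor_closed[OF vw]
    have "F (v \<otimes>\<^bsub>V,W\<^esub> w + ?s) = F (v \<otimes>\<^bsub>V,W\<^esub> w) + F ?s"
      "G (v \<otimes>\<^bsub>V,W\<^esub> w + ?s) = G (v \<otimes>\<^bsub>V,W\<^esub> w) + G ?s"
      using F G vw' s(1) unfolding linear_map_def by blast+
    then show ?case
      using T.add_closed[OF vw' s(1)] eq[OF vw] s(2)
      by (simp only: p list.map sum_list.Cons prod.case simp_thms)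
  qed
  from this[OF tensor_rep(1)[OF V W t]] show ?thesis using tensor_rep(2)[OF V W t] by simp
qed


section \<open>Hopf algebras\<close>

text \<open>One record carries the data of algebras, coalgebras and bialgebras.\<close>

record ('k, 'v) bialgebra = "('k, 'v) vspace" +
  mult :: "'v \<Rightarrow> 'v \<Rightarrow> 'v"  (infixl "\<cdot>\<index>" 75)
  one :: 'v  ("\<one>\<index>")
  comult :: "'v \<Rightarrow> ('k, 'v, 'v) tensor"  ("\<Delta>\<index>")
  counit :: "'v \<Rightarrow> 'k"  ("\<epsilon>\<index>")

definition sweedler ::
  "('k::field, 'v::ab_group_add, 'm) bialgebra_scheme \<Rightarrow> 'v \<Rightarrow> ('v \<times> 'v) list" where
  "sweedler C c = tensor_rep C C (\<Delta>\<^bsub>C\<^esub> c)"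

locale algebra = vspace A
  for A :: "('k::field, 'v::ab_group_add, 'm) bialgebra_scheme" (structure) +
  assumes bilinear_mult: "bilinear_map A A A (\<cdot>)"
    and one_closed: "\<one> \<in> carrier A"
    and mult_assoc: "\<lbrakk>x \<in> carrier A; y \<in> carrier A; z \<in> carrier A\<rbrakk>
      \<Longrightarrow> (x \<cdot> y) \<cdot> z = x \<cdot> (y \<cdot> z)"
    and one_mult: "x \<in> carrier A \<Longrightarrow> \<one> \<cdot> x = x"
    and mult_one: "x \<in> carrier A \<Longrightarrow> x \<cdot> \<one> = x"

locale coalgebra = vspace C
  for C :: "('k::field, 'v::ab_group_add, 'm) bialgebra_scheme" (structure) +
  assumes linear_comult: "linear_map C (tensor C C) \<Delta>"
    and linear_counit: "linear_map C ground \<epsilon>"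
    and coassoc: "c \<in> carrier C \<Longrightarrow>
      (\<Sum>(x, y)\<leftarrow>sweedler C c. \<Sum>(x1, x2)\<leftarrow>sweedler C x. x1 \<otimes>\<^bsub>C,tensor C C\<^esub> (x2 \<otimes>\<^bsub>C,C\<^esub> y)) =
      (\<Sum>(x, y)\<leftarrow>sweedler C c. \<Sum>(y1, y2)\<leftarrow>sweedler C y. x \<otimes>\<^bsub>C,tensor C C\<^esub> (y1 \<otimes>\<^bsub>C,C\<^esub> y2))"
    and counit_left: "c \<in> carrier C \<Longrightarrow> (\<Sum>(x, y)\<leftarrow>sweedler C c. \<epsilon> x \<odot> y) = c"
    and counit_right: "c \<in> carrier C \<Longrightarrow> (\<Sum>(x, y)\<leftarrow>sweedler C c. \<epsilon> y \<odot> x) = c"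

locale bialgebra = algebra B + coalgebra B
  for B :: "('k::field, 'v::ab_group_add, 'm) bialgebra_scheme" (structure) +
  assumes comult_mult: "\<lbrakk>x \<in> carrier B; y \<in> carrier B\<rbrakk> \<Longrightarrow>
      \<Delta> (x \<cdot> y) = (\<Sum>(x1, x2)\<leftarrow>sweedler B x. \<Sum>(y1, y2)\<leftarrow>sweedler B y. (x1 \<cdot> y1) \<otimes>\<^bsub>B,B\<^esub> (x2 \<cdot> y2))"
    and comult_one: "\<Delta> \<one> = \<one> \<otimes>\<^bsub>B,B\<^esub> \<one>"
    and counit_mult: "\<lbrakk>x \<in> carrier B; y \<in> carrier B\<rbrakk> \<Longrightarrow> \<epsilon> (x \<cdot> y) = \<epsilon> x * \<epsilon> y"
    and counit_one: "\<epsilon> \<one> = 1"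

definition is_antipode ::
  "('k::field, 'v::ab_group_add, 'm) bialgebra_scheme \<Rightarrow> ('v \<Rightarrow> 'v) \<Rightarrow> bool" where
  "is_antipode B S \<longleftrightarrow> linear_map B B S \<and>
     (\<forall>x\<in>carrier B.
        (\<Sum>(x1, x2)\<leftarrow>sweedler B x. S x1 \<cdot>\<^bsub>B\<^esub> x2) = \<epsilon>\<^bsub>B\<^esub> x \<odot>\<^bsub>B\<^esub> \<one>\<^bsub>B\<^esub> \<and>
        (\<Sum>(x1, x2)\<leftarrow>sweedler B x. x1 \<cdot>\<^bsub>B\<^esub> S x2) = \<epsilon>\<^bsub>B\<^esub> x \<odot>\<^bsub>B\<^esub> \<one>\<^bsub>B\<^esub>)"

locale hopf_algebra = bialgebra H
  for H :: "('k::field, 'v::ab_group_add, 'm) bialgebra_scheme" (structure) +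
  assumes ex_antipode: "\<exists>S. is_antipode H S"

text \<open>On the carrier of a Hopf algebra the antipode is unique, so the choice is immaterial.\<close>

definition antipode ::
  "('k::field, 'v::ab_group_add, 'm) bialgebra_scheme \<Rightarrow> 'v \<Rightarrow> 'v" where
  "antipode H = (SOME S. is_antipode H S)"


section \<open>Morphisms\<close>

definition algebra_map ::
  "('k::field, 'v::ab_group_add, 'm) bialgebra_scheme
    \<Rightarrow> ('k, 'w::ab_group_add, 'n) bialgebra_scheme \<Rightarrow> ('v \<Rightarrow> 'w) \<Rightarrow> bool" where
  "algebra_map A B f \<longleftrightarrow> linear_map A B f \<and>
     (\<forall>x\<in>carrier A. \<forall>y\<in>carrier A. f (x \<cdot>\<^bsub>A\<^esub> y) = f x \<cdot>\<^bsub>B\<^esub> f y) \<and>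
     f \<one>\<^bsub>A\<^esub> = \<one>\<^bsub>B\<^esub>"

definition coalgebra_map ::
  "('k::field, 'v::ab_group_add, 'm) bialgebra_scheme
    \<Rightarrow> ('k, 'w::ab_group_add, 'n) bialgebra_scheme \<Rightarrow> ('v \<Rightarrow> 'w) \<Rightarrow> bool" where
  "coalgebra_map C D f \<longleftrightarrow> linear_map C D f \<and>
     (\<forall>c\<in>carrier C.
        \<Delta>\<^bsub>D\<^esub> (f c) = (\<Sum>(c1, c2)\<leftarrow>sweedler C c. f c1 \<otimes>\<^bsub>D,D\<^esub> f c2) \<and> \<epsilon>\<^bsub>D\<^esub> (f c) = \<epsilon>\<^bsub>C\<^esub> c)"

text \<open>
  A Hopf algebra map is a bialgebra map; compatibility with the antipodes is automatic.
\<close>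

definition hopf_hom ::
  "('k::field, 'v::ab_group_add, 'm) bialgebra_scheme
    \<Rightarrow> ('k, 'w::ab_group_add, 'n) bialgebra_scheme \<Rightarrow> ('v \<Rightarrow> 'w) \<Rightarrow> bool" where
  "hopf_hom A B f \<longleftrightarrow> algebra_map A B f \<and> coalgebra_map A B f"

definition hopf_iso ::
  "('k::field, 'v::ab_group_add, 'm) bialgebra_scheme
    \<Rightarrow> ('k, 'w::ab_group_add, 'n) bialgebra_scheme \<Rightarrow> ('v \<Rightarrow> 'w) \<Rightarrow> bool" where
  "hopf_iso A B f \<longleftrightarrow> hopf_hom A B f \<and> bij_betw f (carrier A) (carrier B)"

definition unitary ::
  "('k::field, 'v::ab_group_add, 'm) bialgebra_scheme
    \<Rightarrow> ('k, 'w::ab_group_add, 'n) bialgebra_scheme \<Rightarrow> ('v \<Rightarrow> 'w) \<Rightarrow> bool" where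
  "unitary H A r \<longleftrightarrow> r \<one>\<^bsub>H\<^esub> = \<one>\<^bsub>A\<^esub>"

definition cocentral ::
  "('k::field, 'v::ab_group_add, 'm) bialgebra_scheme
    \<Rightarrow> ('k, 'w::ab_group_add, 'n) bialgebra_scheme \<Rightarrow> ('v \<Rightarrow> 'w) \<Rightarrow> bool" where
  "cocentral H A r \<longleftrightarrow> coalgebra_map H A r \<and>
     (\<forall>h\<in>carrier H. (\<Sum>(h1, h2)\<leftarrow>sweedler H h. r h1 \<otimes>\<^bsub>A,H\<^esub> h2) =
                      (\<Sum>(h1, h2)\<leftarrow>sweedler H h. r h2 \<otimes>\<^bsub>A,H\<^esub> h1))"


section \<open>Actions\<close>

text \<open>
  A linear map on \<open>C \<otimes> D\<close> is given as the corresponding bilinear map on \<open>C \<times> D\<close>.  Since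
  \<open>\<Delta>(c \<otimes> d) = \<Sum> (c1 \<otimes> d1) \<otimes> (c2 \<otimes> d2)\<close> and \<open>\<epsilon>(c \<otimes> d) = \<epsilon>(c) \<epsilon>(d)\<close>, the
  following says that it is a coalgebra map \<open>C \<otimes> D \<rightarrow> E\<close>.
\<close>

definition coalgebra_map2 ::
  "('k::field, 'v::ab_group_add, 'm) bialgebra_scheme
    \<Rightarrow> ('k, 'w::ab_group_add, 'n) bialgebra_scheme
    \<Rightarrow> ('k, 'x::ab_group_add, 'l) bialgebra_scheme \<Rightarrow> ('v \<Rightarrow> 'w \<Rightarrow> 'x) \<Rightarrow> bool" where
  "coalgebra_map2 C D E f \<longleftrightarrow> bilinear_map C D E f \<and>
     (\<forall>c\<in>carrier C. \<forall>d\<in>carrier D.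
        \<Delta>\<^bsub>E\<^esub> (f c d) = (\<Sum>(c1, c2)\<leftarrow>sweedler C c. \<Sum>(d1, d2)\<leftarrow>sweedler D d. f c1 d1 \<otimes>\<^bsub>E,E\<^esub> f c2 d2) \<and>
        \<epsilon>\<^bsub>E\<^esub> (f c d) = \<epsilon>\<^bsub>C\<^esub> c * \<epsilon>\<^bsub>D\<^esub> d)"

definition left_module ::
  "('k::field, 'h::ab_group_add, 'm) bialgebra_scheme
    \<Rightarrow> ('k, 'a::ab_group_add, 'n) vspace_scheme \<Rightarrow> ('h \<Rightarrow> 'a \<Rightarrow> 'a) \<Rightarrow> bool" where
  "left_module H A act \<longleftrightarrow> bilinear_map H A A act \<and>
     (\<forall>a\<in>carrier A. act \<one>\<^bsub>H\<^esub> a = a) \<and>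
     (\<forall>g\<in>carrier H. \<forall>h\<in>carrier H. \<forall>a\<in>carrier A. act (g \<cdot>\<^bsub>H\<^esub> h) a = act g (act h a))"

definition right_module ::
  "('k::field, 'a::ab_group_add, 'm) bialgebra_scheme
    \<Rightarrow> ('k, 'h::ab_group_add, 'n) vspace_scheme \<Rightarrow> ('h \<Rightarrow> 'a \<Rightarrow> 'h) \<Rightarrow> bool" where
  "right_module A H act \<longleftrightarrow> bilinear_map H A H act \<and>
     (\<forall>h\<in>carrier H. act h \<one>\<^bsub>A\<^esub> = h) \<and>
     (\<forall>h\<in>carrier H. \<forall>a\<in>carrier A. \<forall>b\<in>carrier A. act h (a \<cdot>\<^bsub>A\<^esub> b) = act (act h a) b)"

definition left_module_algebra ::
  "('k::field, 'h::ab_group_add, 'm) bialgebra_scheme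
    \<Rightarrow> ('k, 'a::ab_group_add, 'n) bialgebra_scheme \<Rightarrow> ('h \<Rightarrow> 'a \<Rightarrow> 'a) \<Rightarrow> bool" where
  "left_module_algebra H A act \<longleftrightarrow> left_module H A act \<and>
     (\<forall>h\<in>carrier H. \<forall>a\<in>carrier A. \<forall>b\<in>carrier A.
        act h (a \<cdot>\<^bsub>A\<^esub> b) = (\<Sum>(h1, h2)\<leftarrow>sweedler H h. act h1 a \<cdot>\<^bsub>A\<^esub> act h2 b)) \<and>
     (\<forall>h\<in>carrier H. act h \<one>\<^bsub>A\<^esub> = \<epsilon>\<^bsub>H\<^esub> h \<odot>\<^bsub>A\<^esub> \<one>\<^bsub>A\<^esub>)"

definition left_module_coalgebra ::
  "('k::field, 'h::ab_group_add, 'm) bialgebra_scheme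
    \<Rightarrow> ('k, 'a::ab_group_add, 'n) bialgebra_scheme \<Rightarrow> ('h \<Rightarrow> 'a \<Rightarrow> 'a) \<Rightarrow> bool" where
  "left_module_coalgebra H A act \<longleftrightarrow> left_module H A act \<and> coalgebra_map2 H A A act"

definition trivial_right_action ::
  "('k::field, 'a::ab_group_add, 'm) bialgebra_scheme
    \<Rightarrow> ('k, 'h::ab_group_add, 'n) vspace_scheme \<Rightarrow> ('h \<Rightarrow> 'a \<Rightarrow> 'h) \<Rightarrow> bool" where
  "trivial_right_action A H act \<longleftrightarrow>
     (\<forall>h\<in>carrier H. \<forall>a\<in>carrier A. act h a = \<epsilon>\<^bsub>A\<^esub> a \<odot>\<^bsub>H\<^esub> h)"


section \<open>Matched pairs, bicrossed products and smash products\<close>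

locale matched_pair = A: hopf_algebra A + H: hopf_algebra H
  for A :: "('k::field, 'a::ab_group_add) bialgebra"
    and H :: "('k, 'h::ab_group_add) bialgebra" +
  fixes lact :: "'h \<Rightarrow> 'a \<Rightarrow> 'a"  (infixr "\<triangleright>" 80)
    and ract :: "'h \<Rightarrow> 'a \<Rightarrow> 'h"  (infixl "\<triangleleft>" 80)
  assumes lact_coalgebra_map: "coalgebra_map2 H A A (\<triangleright>)"
    and ract_coalgebra_map: "coalgebra_map2 H A H (\<triangleleft>)"
    and lact_module: "left_module H A (\<triangleright>)"
    and ract_module: "right_module A H (\<triangleleft>)"
    and lact_one: "h \<in> carrier H \<Longrightarrow> h \<triangleright> \<one>\<^bsub>A\<^esub> = \<epsilon>\<^bsub>H\<^esub> h \<odot>\<^bsub>A\<^esub> \<one>\<^bsub>A\<^esub>"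
    and one_ract: "a \<in> carrier A \<Longrightarrow> \<one>\<^bsub>H\<^esub> \<triangleleft> a = \<epsilon>\<^bsub>A\<^esub> a \<odot>\<^bsub>H\<^esub> \<one>\<^bsub>H\<^esub>"
    and lact_mult: "\<lbrakk>g \<in> carrier H; a \<in> carrier A; b \<in> carrier A\<rbrakk> \<Longrightarrow>
      g \<triangleright> (a \<cdot>\<^bsub>A\<^esub> b) =
      (\<Sum>(g1, g2)\<leftarrow>sweedler H g. \<Sum>(a1, a2)\<leftarrow>sweedler A a. (g1 \<triangleright> a1) \<cdot>\<^bsub>A\<^esub> ((g2 \<triangleleft> a2) \<triangleright> b))"
    and mult_ract: "\<lbrakk>g \<in> carrier H; h \<in> carrier H; a \<in> carrier A\<rbrakk> \<Longrightarrow>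
      (g \<cdot>\<^bsub>H\<^esub> h) \<triangleleft> a =
      (\<Sum>(h1, h2)\<leftarrow>sweedler H h. \<Sum>(a1, a2)\<leftarrow>sweedler A a. (g \<triangleleft> (h1 \<triangleright> a1)) \<cdot>\<^bsub>H\<^esub> (h2 \<triangleleft> a2))"
    and ract_lact_symmetric: "\<lbrakk>g \<in> carrier H; a \<in> carrier A\<rbrakk> \<Longrightarrow>
      (\<Sum>(g1, g2)\<leftarrow>sweedler H g. \<Sum>(a1, a2)\<leftarrow>sweedler A a. (g1 \<triangleleft> a1) \<otimes>\<^bsub>H,A\<^esub> (g2 \<triangleright> a2)) =
      (\<Sum>(g1, g2)\<leftarrow>sweedler H g. \<Sum>(a1, a2)\<leftarrow>sweedler A a. (g2 \<triangleleft> a2) \<otimes>\<^bsub>H,A\<^esub> (g1 \<triangleright> a1))"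

definition tensor_comult ::
  "('k::field, 'v::ab_group_add, 'm) bialgebra_scheme
    \<Rightarrow> ('k, 'w::ab_group_add, 'n) bialgebra_scheme
    \<Rightarrow> ('k, 'v, 'w) tensor \<Rightarrow> ('k, ('k, 'v, 'w) tensor, ('k, 'v, 'w) tensor) tensor" where
  "tensor_comult C D t =
     (\<Sum>(c, d)\<leftarrow>tensor_rep C D t. \<Sum>(c1, c2)\<leftarrow>sweedler C c. \<Sum>(d1, d2)\<leftarrow>sweedler D d.
        (c1 \<otimes>\<^bsub>C,D\<^esub> d1) \<otimes>\<^bsub>tensor C D,tensor C D\<^esub> (c2 \<otimes>\<^bsub>C,D\<^esub> d2))"

definition tensor_counit ::
  "('k::field, 'v::ab_group_add, 'm) bialgebra_scheme
    \<Rightarrow> ('k, 'w::ab_group_add, 'n) bialgebra_scheme \<Rightarrow> ('k, 'v, 'w) tensor \<Rightarrow> 'k" where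
  "tensor_counit C D t = (\<Sum>(c, d)\<leftarrow>tensor_rep C D t. \<epsilon>\<^bsub>C\<^esub> c * \<epsilon>\<^bsub>D\<^esub> d)"

definition bicrossed_product ::
  "('k::field, 'a::ab_group_add) bialgebra \<Rightarrow> ('k, 'h::ab_group_add) bialgebra
    \<Rightarrow> ('h \<Rightarrow> 'a \<Rightarrow> 'a) \<Rightarrow> ('h \<Rightarrow> 'a \<Rightarrow> 'h) \<Rightarrow> ('k, ('k, 'a, 'h) tensor) bialgebra" where
  "bicrossed_product A H lact ract =
     \<lparr>carrier = carrier (tensor A H), scale = scale (tensor A H),
      mult = (\<lambda>x y. \<Sum>(a, h)\<leftarrow>tensor_rep A H x. \<Sum>(c, g)\<leftarrow>tensor_rep A H y.
                \<Sum>(h1, h2)\<leftarrow>sweedler H h. \<Sum>(c1, c2)\<leftarrow>sweedler A c.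
                  (a \<cdot>\<^bsub>A\<^esub> lact h1 c1) \<otimes>\<^bsub>A,H\<^esub> (ract h2 c2 \<cdot>\<^bsub>H\<^esub> g)),
      one = \<one>\<^bsub>A\<^esub> \<otimes>\<^bsub>A,H\<^esub> \<one>\<^bsub>H\<^esub>,
      comult = tensor_comult A H,
      counit = tensor_counit A H\<rparr>"

definition smash_product ::
  "('k::field, 'a::ab_group_add) bialgebra \<Rightarrow> ('k, 'h::ab_group_add) bialgebra
    \<Rightarrow> ('h \<Rightarrow> 'a \<Rightarrow> 'a) \<Rightarrow> ('k, ('k, 'a, 'h) tensor) bialgebra" where
  "smash_product A H lact =
     \<lparr>carrier = carrier (tensor A H), scale = scale (tensor A H),
      mult = (\<lambda>x y. \<Sum>(a, h)\<leftarrow>tensor_rep A H x. \<Sum>(c, g)\<leftarrow>tensor_rep A H y.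
                \<Sum>(h1, h2)\<leftarrow>sweedler H h. (a \<cdot>\<^bsub>A\<^esub> lact h1 c) \<otimes>\<^bsub>A,H\<^esub> (h2 \<cdot>\<^bsub>H\<^esub> g)),
      one = \<one>\<^bsub>A\<^esub> \<otimes>\<^bsub>A,H\<^esub> \<one>\<^bsub>H\<^esub>,
      comult = tensor_comult A H,
      counit = tensor_counit A H\<rparr>"

text \<open>
  \<open>E\<close> and \<open>E'\<close> are algebras on \<open>A \<otimes> H\<close> and \<open>A \<otimes> H'\<close>, regarded as left \<open>A\<close>-modules by
  multiplication through \<open>a \<mapsto> a \<otimes> 1\<close>.
\<close>

definition left_linear ::
  "('k::field, 'a::ab_group_add) bialgebra \<Rightarrow> ('k, 'h::ab_group_add) bialgebra
    \<Rightarrow> ('k, 'g::ab_group_add) bialgebra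
    \<Rightarrow> ('k, ('k, 'a, 'h) tensor) bialgebra \<Rightarrow> ('k, ('k, 'a, 'g) tensor) bialgebra
    \<Rightarrow> (('k, 'a, 'h) tensor \<Rightarrow> ('k, 'a, 'g) tensor) \<Rightarrow> bool" where
  "left_linear A H H' E E' f \<longleftrightarrow> linear_map E E' f \<and>
     (\<forall>a\<in>carrier A. \<forall>x\<in>carrier E.
        f ((a \<otimes>\<^bsub>A,H\<^esub> \<one>\<^bsub>H\<^esub>) \<cdot>\<^bsub>E\<^esub> x) = (a \<otimes>\<^bsub>A,H'\<^esub> \<one>\<^bsub>H'\<^esub>) \<cdot>\<^bsub>E'\<^esub> f x)"

end

theory Submission
  imports Defs
begin

text \<open>
  A left \<open>A\<close>-linear map \<open>\<psi>\<close> out of \<open>A \<bowtie> H\<close> is determined by the values \<open>\<psi>(1 \<bowtie> h)\<close>, because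
  \<open>a \<bowtie> h = (a \<bowtie> 1)(1 \<bowtie> h)\<close>.  If \<open>\<psi>\<close> is a coalgebra map, then so is \<open>h \<mapsto> \<psi>(1 \<bowtie> h)\<close>, and a
  coalgebra map into \<open>A \<otimes> H'\<close> is recovered from its two components \<open>r = (id \<otimes> \<epsilon>)\<psi>(1 \<bowtie> -)\<close> and
  \<open>v = (\<epsilon> \<otimes> id)\<psi>(1 \<bowtie> -)\<close> in two ways: \<open>r(h\<^sub>1) \<otimes> v(h\<^sub>2) = r(h\<^sub>2) \<otimes> v(h\<^sub>1)\<close>
  (\<open>j_fst_snd\<close>, \<open>j_snd_fst\<close>).  Hence \<open>\<psi>(a \<bowtie> h) = a r(h\<^sub>1) # v(h\<^sub>2)\<close>, and once \<open>v\<close> is known to be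
  bijective the equality of the two expressions is cocentrality of \<open>r\<close>.

  Bijectivity of \<open>v\<close> comes from \<open>A\<close>-linearity: \<open>\<psi>\<close> and its inverse both descend along
  \<open>\<epsilon> \<otimes> id\<close>, to \<open>v\<close> and to an inverse of \<open>v\<close> (\<open>snd_psi\<close>, \<open>snd_phi\<close>).  Multiplicativity of
  \<open>\<psi>\<close> on \<open>(1 \<bowtie> h)(1 \<bowtie> g)\<close> says that \<open>v\<close> is multiplicative and that \<open>r\<close> satisfies the
  compatibility condition.  On \<open>(1 \<bowtie> h)(a \<bowtie> 1)\<close> it says
  \<open>(h\<^sub>1 \<triangleright> a\<^sub>1) r(h\<^sub>2 \<triangleleft> a\<^sub>2) # v(h\<^sub>3 \<triangleleft> a\<^sub>3) = r(h\<^sub>1)(v(h\<^sub>2) \<triangleright>' a) # v(h\<^sub>3)\<close>.  Applying \<open>\<epsilon> \<otimes> id\<close>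
  gives \<open>v(h \<triangleleft> a) = \<epsilon>(a) v(h)\<close>, so \<open>\<triangleleft>\<close> is trivial; applying \<open>id \<otimes> \<epsilon>\<close> then gives
  \<open>(h\<^sub>1 \<triangleright> a) r(h\<^sub>2) = r(h\<^sub>1)(v(h\<^sub>2) \<triangleright>' a)\<close>, which becomes the formula for \<open>\<triangleright>\<close> on
  convolving with \<open>S\<^sub>A \<circ> r\<close>, the convolution inverse of \<open>r\<close>.

  Conversely, \<open>\<psi>(a \<bowtie> h) = a r(h\<^sub>1) # v(h\<^sub>2)\<close> has inverse
  \<open>a # v(h) \<mapsto> a S\<^sub>A(r(h\<^sub>1)) \<bowtie> h\<^sub>2\<close>.  It respects \<open>\<Delta>\<close> because cocentrality exchanges the two
  middle factors of \<open>h\<^sub>1 \<otimes> h\<^sub>2 \<otimes> h\<^sub>3 \<otimes> h\<^sub>4\<close> (\<open>sw_middle\<close>), and it respects products because of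
  \<open>(h\<^sub>1 \<triangleright> c) r(h\<^sub>2 g) = r(h\<^sub>1)(v(h\<^sub>2) \<triangleright>' (c r(g)))\<close> (\<open>lact_mult_r\<close>).
\<close>

section \<open>Linear maps out of tensor products, and Sweedler sums\<close>

definition tlift ::
  "('k::field, 'v::ab_group_add, 'm) vspace_scheme \<Rightarrow> ('k, 'w::ab_group_add, 'n) vspace_scheme
    \<Rightarrow> ('v \<Rightarrow> 'w \<Rightarrow> 'x::ab_group_add) \<Rightarrow> ('k, 'v, 'w) tensor \<Rightarrow> 'x" where
  "tlift V W f t = (\<Sum>(v, w)\<leftarrow>tensor_rep V W t. f v w)"

text \<open>
  The Sweedler sum \<open>\<Sum> f c\<^sub>1 c\<^sub>2\<close>.  It is a constant of its own so that the coalgebra laws can be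
  stated as rewrite rules for it.
\<close>

definition sw ::
  "('k::field, 'v::ab_group_add, 'm) bialgebra_scheme \<Rightarrow> 'v
    \<Rightarrow> ('v \<Rightarrow> 'v \<Rightarrow> 'x::ab_group_add) \<Rightarrow> 'x" where
  "sw C c f = (\<Sum>(x, y)\<leftarrow>sweedler C c. f x y)"

lemma sw_tlift: "sw C c f = tlift C C f (\<Delta>\<^bsub>C\<^esub> c)"
  by (simp add: sw_def tlift_def sweedler_def)

text \<open>
  Manipulating a Sweedler sum presupposes that its summand is multilinear and stays in the
  carriers.  The rules \<open>lin\<close> decide this by the shape of the summand: a multilinear expression
  contains each variable once, so linearity in that variable follows operation by operation.  The
  collection also moves scalars to the outside and then cancels counits.
\<close>

named_theorems lin

lemma vspace_ground [lin]: "vspace ground"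
  unfolding vspace_def ground_def
  by (auto simp: module.subspace_def module_def vector_space_def algebra_simps)

declare vspace_tensor [lin]

lemma ground_simps [simp]: "carrier ground = UNIV" "scale ground = (*)"
  by (simp_all add: ground_def)

lemma linear_map_closed: "linear_map V W f \<Longrightarrow> x \<in> carrier V \<Longrightarrow> f x \<in> carrier W"
  and linear_map_add:
    "linear_map V W f \<Longrightarrow> x \<in> carrier V \<Longrightarrow> y \<in> carrier V \<Longrightarrow> f (x + y) = f x + f y"
  and linear_map_scale: "linear_map V W f \<Longrightarrow> x \<in> carrier V \<Longrightarrow> f (c \<odot>\<^bsub>V\<^esub> x) = c \<odot>\<^bsub>W\<^esub> f x"
  by (simp_all add: linear_map_def)

lemma linear_map_zero:
  assumes "vspace V" "linear_map V W f" shows "f 0 = 0"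
  using linear_map_add[OF assms(2) vspace.zero_closed[OF assms(1)] vspace.zero_closed[OF assms(1)]]
  by simp

lemma bilinear_map_iff [lin]:
  "bilinear_map V W X f \<longleftrightarrow>
    (\<forall>x\<in>carrier V. linear_map W X (\<lambda>y. f x y)) \<and> (\<forall>y\<in>carrier W. linear_map V X (\<lambda>x. f x y))"
  by (simp add: bilinear_map_def)

lemma linear_map_id [lin]: "linear_map V V (\<lambda>x. x)"
  by (simp add: linear_map_def)

lemma linear_map_comp:
  assumes "linear_map W X f" "linear_map V W t"
  shows "linear_map V X (\<lambda>x. f (t x))"
  using assms by (simp add: linear_map_def)

lemma bilinear_map_comp_left:
  assumes "bilinear_map W Y X f" "linear_map V W t" "b \<in> carrier Y"
  shows "linear_map V X (\<lambda>x. f (t x) b)"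
  using assms by (simp add: linear_map_def bilinear_map_def)

lemma bilinear_map_comp_right:
  assumes "bilinear_map Y W X f" "linear_map V W t" "b \<in> carrier Y"
  shows "linear_map V X (\<lambda>x. f b (t x))"
  using assms by (simp add: linear_map_def bilinear_map_def)

lemma bilinear_map_closed:
  "bilinear_map V W X f \<Longrightarrow> x \<in> carrier V \<Longrightarrow> y \<in> carrier W \<Longrightarrow> f x y \<in> carrier X"
  by (simp add: linear_map_def bilinear_map_def)

lemma bilinear_map_scale_left:
  "bilinear_map V W X f \<Longrightarrow> x \<in> carrier V \<Longrightarrow> y \<in> carrier W \<Longrightarrow> f (c \<odot>\<^bsub>V\<^esub> x) y = c \<odot>\<^bsub>X\<^esub> f x y"
  and bilinear_map_scale_right:
  "bilinear_map V W X f \<Longrightarrow> x \<in> carrier V \<Longrightarrow> y \<in> carrier W \<Longrightarrow> f x (c \<odot>\<^bsub>W\<^esub> y) = c \<odot>\<^bsub>X\<^esub> f x y"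
  by (auto simp: linear_map_def bilinear_map_def)

text \<open>
  Products of scalars are split up, so that a counit \<open>\<epsilon> c\<^sub>1\<close> hidden in such a product comes to stand
  alone and the counit laws match.
\<close>

lemma scale_mult:
  assumes "vspace X"
  shows "(a * b) \<odot>\<^bsub>X\<^esub> x = a \<odot>\<^bsub>X\<^esub> b \<odot>\<^bsub>X\<^esub> x"
    and "a \<odot>\<^bsub>X\<^esub> b \<odot>\<^bsub>X\<^esub> x = b \<odot>\<^bsub>X\<^esub> a \<odot>\<^bsub>X\<^esub> x"
proof -
  interpret X: vspace X by fact
  show "(a * b) \<odot>\<^bsub>X\<^esub> x = a \<odot>\<^bsub>X\<^esub> b \<odot>\<^bsub>X\<^esub> x" "a \<odot>\<^bsub>X\<^esub> b \<odot>\<^bsub>X\<^esub> x = b \<odot>\<^bsub>X\<^esub> a \<odot>\<^bsub>X\<^esub> x"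
    by (simp_all add: mult.commute)
qed

lemma linear_map_scale_right [lin]:
  assumes "vspace X" "linear_map V X t"
  shows "linear_map V X (\<lambda>x. c \<odot>\<^bsub>X\<^esub> t x)"
proof -
  interpret X: vspace X by fact
  show ?thesis using assms(2)
    by (simp add: linear_map_def X.vs.scale_right_distrib X.scale_closed mult.commute)
qed

lemma linear_map_scale_left [lin]:
  assumes "vspace X" "linear_map V ground t" "b \<in> carrier X"
  shows "linear_map V X (\<lambda>x. t x \<odot>\<^bsub>X\<^esub> b)"
proof -
  interpret X: vspace X by fact
  show ?thesis using assms(2,3)
    by (simp add: linear_map_def X.vs.scale_left_distrib X.scale_closed)
qed

lemma linear_map_times_left [lin]:
  "linear_map V ground t \<Longrightarrow> linear_map V ground (\<lambda>x. t x * c)"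
  by (simp add: linear_map_def algebra_simps)

lemma linear_map_times_right [lin]:
  "linear_map V ground t \<Longrightarrow> linear_map V ground (\<lambda>x. c * t x)"
  by (simp add: linear_map_def algebra_simps)

lemmas pure_tensor_lin [lin] =
  pure_tensor_closed
  bilinear_map_comp_left[OF bilinear_pure_tensor]
  bilinear_map_comp_right[OF bilinear_pure_tensor]

lemma pure_tensor_scale_left:
  "a \<in> carrier V \<Longrightarrow> b \<in> carrier W \<Longrightarrow>
    (c \<odot>\<^bsub>V\<^esub> a) \<otimes>\<^bsub>V,W\<^esub> b = c \<odot>\<^bsub>tensor V W\<^esub> (a \<otimes>\<^bsub>V,W\<^esub> b)"
  using bilinear_pure_tensor[of V W] by (auto simp: bilinear_map_def linear_map_def)

lemma pure_tensor_scale_right: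
  "a \<in> carrier V \<Longrightarrow> b \<in> carrier W \<Longrightarrow>
    a \<otimes>\<^bsub>V,W\<^esub> (c \<odot>\<^bsub>W\<^esub> b) = c \<odot>\<^bsub>tensor V W\<^esub> (a \<otimes>\<^bsub>V,W\<^esub> b)"
  using bilinear_pure_tensor[of V W] by (auto simp: bilinear_map_def linear_map_def)

lemma tlift_pure:
  assumes "vspace V" "vspace W" "vspace X" "bilinear_map V W X f" "v \<in> carrier V" "w \<in> carrier W"
  shows "tlift V W f (v \<otimes>\<^bsub>V,W\<^esub> w) = f v w"
  using tensor_universal(2)[OF assms] by (simp add: tlift_def)

lemma linear_map_tlift:
  assumes "vspace V" "vspace W" "vspace X" "bilinear_map V W X f"
  shows "linear_map (tensor V W) X (tlift V W f)"
  using tensor_universal(1)[OF assms] by (simp add: tlift_def[abs_def])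

lemma linear_map_tlift_outer [lin]:
  assumes "linear_map U (tensor V W) t" "vspace V" "vspace W" "vspace X" "bilinear_map V W X f"
  shows "linear_map U X (\<lambda>x. tlift V W f (t x))"
  by (rule linear_map_comp[OF linear_map_tlift assms(1)]) (use assms in auto)

lemma sum_list_closed:
  assumes "vspace X" "\<And>v w. (v, w) \<in> set ps \<Longrightarrow> f v w \<in> carrier X"
  shows "(\<Sum>(v, w)\<leftarrow>ps. f v w) \<in> carrier X"
  using assms(2) by (induction ps) (auto simp: vspace.zero_closed[OF assms(1)] vspace.add_closed[OF assms(1)])

lemma linear_map_sum_list:
  assumes X: "vspace X" and Y: "vspace Y" and g: "linear_map X Y g"
    and f: "\<And>v w. (v, w) \<in> set ps \<Longrightarrow> f v w \<in> carrier X"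
  shows "g (\<Sum>(v, w)\<leftarrow>ps. f v w) = (\<Sum>(v, w)\<leftarrow>ps. g (f v w))"
  using f
proof (induction ps)
  case Nil
  show ?case by (simp add: linear_map_zero[OF X g])
next
  case (Cons p ps)
  obtain v w where p: "p = (v, w)" by fastforce
  have "f v w \<in> carrier X" "(\<Sum>(v, w)\<leftarrow>ps. f v w) \<in> carrier X"
    using Cons.prems p by (auto intro: sum_list_closed[OF X])
  then show ?case using Cons by (simp add: p linear_map_add[OF g])
qed

lemma linear_map_sum_list_inner:
  assumes U: "vspace U" and X: "vspace X"
    and f: "\<And>v w. (v, w) \<in> set ps \<Longrightarrow> linear_map U X (\<lambda>x. f x v w)"
  shows "linear_map U X (\<lambda>x. \<Sum>(v, w)\<leftarrow>ps. f x v w)"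
  using f
proof (induction ps)
  case Nil
  interpret X: vspace X by fact
  show ?case by (simp add: linear_map_def X.zero_closed)
next
  case (Cons p ps)
  interpret X: vspace X by fact
  obtain v w where p: "p = (v, w)" by fastforce
  have "linear_map U X (\<lambda>x. f x v w)" "linear_map U X (\<lambda>x. \<Sum>(v, w)\<leftarrow>ps. f x v w)"
    using Cons p by auto
  then show ?case
    by (simp add: p linear_map_def X.add_closed X.vs.scale_right_distrib algebra_simps)
qed

context
  fixes V :: "('k::field, 'v::ab_group_add, 'm) vspace_scheme"
    and W :: "('k, 'w::ab_group_add, 'n) vspace_scheme"
    and t :: "('k, 'v, 'w) tensor"
  assumes V: "vspace V" and W: "vspace W" and t: "t \<in> carrier (tensor V W)"
begin

lemma tensor_rep_closed:
  assumes "(v, w) \<in> set (tensor_rep V W t)" shows "v \<in> carrier V" "w \<in> carrier W"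
  using tensor_rep(1)[OF V W t] assms by auto

lemma tlift_cong:
  assumes "\<And>v w. v \<in> carrier V \<Longrightarrow> w \<in> carrier W \<Longrightarrow> f v w = g v w"
  shows "tlift V W f t = tlift V W g t"
  unfolding tlift_def using assms tensor_rep_closed
  by (auto intro!: arg_cong[of _ _ sum_list] map_cong)

lemma tlift_closed:
  assumes "vspace X" "\<And>v w. v \<in> carrier V \<Longrightarrow> w \<in> carrier W \<Longrightarrow> f v w \<in> carrier X"
  shows "tlift V W f t \<in> carrier X"
  unfolding tlift_def using assms tensor_rep_closed by (auto intro!: sum_list_closed)

lemma linear_map_tlift_inner:
  assumes "vspace U" "vspace X"
    "\<And>v w. v \<in> carrier V \<Longrightarrow> w \<in> carrier W \<Longrightarrow> linear_map U X (\<lambda>x. f x v w)"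
  shows "linear_map U X (\<lambda>x. tlift V W (f x) t)"
  unfolding tlift_def using assms tensor_rep_closed by (auto intro!: linear_map_sum_list_inner)

lemma linear_map_tlift_commute:
  assumes "linear_map X Y g" "vspace X" "vspace Y"
    "\<And>v w. v \<in> carrier V \<Longrightarrow> w \<in> carrier W \<Longrightarrow> f v w \<in> carrier X"
  shows "g (tlift V W f t) = tlift V W (\<lambda>v w. g (f v w)) t"
  unfolding tlift_def
  by (rule linear_map_sum_list) (use assms tensor_rep_closed in auto)

lemma tlift_pure_tensor: "tlift V W (\<lambda>v w. v \<otimes>\<^bsub>V,W\<^esub> w) t = t"
  unfolding tlift_def by (rule tensor_rep(2)[OF V W t])

end

lemma sum_list_swap:
  fixes f :: "'a \<Rightarrow> 'b \<Rightarrow> 'c \<Rightarrow> 'd \<Rightarrow> 'x::ab_group_add"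
  shows "(\<Sum>(a, b)\<leftarrow>ps. \<Sum>(c, d)\<leftarrow>qs. f a b c d) = (\<Sum>(c, d)\<leftarrow>qs. \<Sum>(a, b)\<leftarrow>ps. f a b c d)"
proof (induction ps)
  case (Cons p ps)
  show ?case
    using Cons.IH by (cases p) (simp add: sum_list_addf case_prod_beta)
qed (simp add: case_prod_beta)

lemma sw_swap: "sw C c (\<lambda>x y. sw D d (\<lambda>z w. f x y z w)) = sw D d (\<lambda>z w. sw C c (\<lambda>x y. f x y z w))"
  unfolding sw_def by (rule sum_list_swap)

declare tlift_closed [lin] linear_map_tlift_inner [lin]

context coalgebra
begin

lemma vspace_C: "vspace C" by unfold_locales

lemma comult_closed: "c \<in> carrier C \<Longrightarrow> \<Delta> c \<in> carrier (tensor C C)"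
  using linear_comult by (rule linear_map_closed)

lemmas sw_cong = tlift_cong[OF vspace_C vspace_C comult_closed, folded sw_tlift]

text \<open>
  The congruence rule for the simplifier: the bound variables run through the carrier, which is what
  the side conditions of the other rules ask for.
\<close>

lemma sw_simp_cong:
  assumes "c = d" "d \<in> carrier C"
    and "\<And>x y. x \<in> carrier C \<Longrightarrow> y \<in> carrier C \<Longrightarrow> f x y = g x y"
  shows "sw C c f = sw C d g"
  unfolding assms(1) using assms(2,3) by (rule sw_cong)

lemmas sw_closed = tlift_closed[OF vspace_C vspace_C comult_closed, folded sw_tlift]
lemmas linear_map_sw_inner = linear_map_tlift_inner[OF vspace_C vspace_C comult_closed, folded sw_tlift]
lemmas sw_linear = linear_map_tlift_commute[OF vspace_C vspace_C comult_closed, folded sw_tlift]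

lemma linear_map_sw_outer:
  assumes "linear_map U C t" "vspace X" "bilinear_map C C X f"
  shows "linear_map U X (\<lambda>x. sw C (t x) f)"
  unfolding sw_tlift
  by (rule linear_map_tlift_outer linear_map_comp[OF linear_comult] assms vspace_C)+

lemma comult_sw: "c \<in> carrier C \<Longrightarrow> \<Delta> c = sw C c (\<lambda>x y. x \<otimes>\<^bsub>C,C\<^esub> y)"
  unfolding sw_tlift by (simp add: tlift_pure_tensor vspace_C comult_closed)

text \<open>
  Coassociativity is an equation in \<open>C \<otimes> (C \<otimes> C)\<close>; the trilinear \<open>f\<close> induces a linear map on that
  space, and applying it to both sides gives the law for arbitrary summands.
\<close>

lemma sw_coassoc:
  assumes X: "vspace X"
    and f1: "\<And>y z. y \<in> carrier C \<Longrightarrow> z \<in> carrier C \<Longrightarrow> linear_map C X (\<lambda>x. f x y z)"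
    and f2: "\<And>x z. x \<in> carrier C \<Longrightarrow> z \<in> carrier C \<Longrightarrow> linear_map C X (\<lambda>y. f x y z)"
    and f3: "\<And>x y. x \<in> carrier C \<Longrightarrow> y \<in> carrier C \<Longrightarrow> linear_map C X (\<lambda>z. f x y z)"
    and c: "c \<in> carrier C"
  shows "sw C c (\<lambda>x y. sw C x (\<lambda>x1 x2. f x1 x2 y)) = sw C c (\<lambda>x y. sw C y (\<lambda>y1 y2. f x y1 y2))"
proof -
  let ?g = "tlift C (tensor C C) (\<lambda>x. tlift C C (f x))"
  note rules = vspace_C vspace_tensor X
  have bil: "bilinear_map C (tensor C C) X (\<lambda>x. tlift C C (f x))"
    by (auto simp: lin rules f1 f2 f3 linear_map_tlift)
  have g: "linear_map (tensor C (tensor C C)) X ?g"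
    by (rule linear_map_tlift) (rule rules bil)+
  have gp: "?g (x \<otimes>\<^bsub>C,tensor C C\<^esub> (y \<otimes>\<^bsub>C,C\<^esub> z)) = f x y z"
    if "x \<in> carrier C" "y \<in> carrier C" "z \<in> carrier C" for x y z
    using that by (simp add: tlift_pure[OF _ _ X] lin rules bil f2 f3 f1)
  have "?g (sw C c (\<lambda>x y. sw C x (\<lambda>x1 x2. x1 \<otimes>\<^bsub>C,tensor C C\<^esub> (x2 \<otimes>\<^bsub>C,C\<^esub> y))))
      = ?g (sw C c (\<lambda>x y. sw C y (\<lambda>y1 y2. x \<otimes>\<^bsub>C,tensor C C\<^esub> (y1 \<otimes>\<^bsub>C,C\<^esub> y2))))"
    using coassoc[OF c] by (simp add: sw_def)
  then show ?thesis
    using c by (simp add: sw_linear[OF _ g] sw_closed rules pure_tensor_closed gp cong: sw_cong)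
qed

text \<open>
  Fourfold coproducts, bracketed as \<open>(c\<^sub>1 \<otimes> c\<^sub>2) \<otimes> (c\<^sub>3 \<otimes> c\<^sub>4)\<close> and as
  \<open>c\<^sub>1 \<otimes> ((c\<^sub>2 \<otimes> c\<^sub>3) \<otimes> c\<^sub>4)\<close>.  The second bracketing exhibits the two middle factors as the coproduct
  of one element, so that a law about \<open>\<Delta>\<close> can be applied to them.
\<close>

lemma sw_middle:
  assumes X: "vspace X"
    and f1: "\<And>x y z. x \<in> carrier C \<Longrightarrow> y \<in> carrier C \<Longrightarrow> z \<in> carrier C \<Longrightarrow> linear_map C X (\<lambda>u. f u x y z)"
    and f2: "\<And>x y z. x \<in> carrier C \<Longrightarrow> y \<in> carrier C \<Longrightarrow> z \<in> carrier C \<Longrightarrow> linear_map C X (\<lambda>u. f x u y z)"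
    and f3: "\<And>x y z. x \<in> carrier C \<Longrightarrow> y \<in> carrier C \<Longrightarrow> z \<in> carrier C \<Longrightarrow> linear_map C X (\<lambda>u. f x y u z)"
    and f4: "\<And>x y z. x \<in> carrier C \<Longrightarrow> y \<in> carrier C \<Longrightarrow> z \<in> carrier C \<Longrightarrow> linear_map C X (\<lambda>u. f x y z u)"
    and c: "c \<in> carrier C"
  shows "sw C c (\<lambda>x y. sw C x (\<lambda>x1 x2. sw C y (\<lambda>y1 y2. f x1 x2 y1 y2)))
    = sw C c (\<lambda>x y. sw C y (\<lambda>p q. sw C p (\<lambda>p1 p2. f x p1 p2 q)))"
proof -
  note s = X vspace_C coalgebra_axioms linear_map_sw_inner linear_map_sw_outer linear_map_id
    bilinear_map_iff f1 f2 f3 f4 c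
  have "sw C c (\<lambda>x y. sw C x (\<lambda>x1 x2. sw C y (\<lambda>y1 y2. f x1 x2 y1 y2)))
      = sw C c (\<lambda>x y. sw C y (\<lambda>y1 y2. sw C y2 (\<lambda>z1 z2. f x y1 z1 z2)))"
    by (rule sw_coassoc[OF X]) (simp_all add: s)
  also have "\<dots> = sw C c (\<lambda>x y. sw C y (\<lambda>p q. sw C p (\<lambda>p1 p2. f x p1 p2 q)))"
    by (intro sw_cong sw_coassoc[OF X, symmetric]) (simp_all add: s)
  finally show ?thesis .
qed

lemma sw_counit_left:
  assumes "linear_map C X f" "vspace X" "c \<in> carrier C"
  shows "sw C c (\<lambda>x y. \<epsilon> x \<odot>\<^bsub>X\<^esub> f y) = f c"
proof -
  have "f c = f (sw C c (\<lambda>x y. \<epsilon> x \<odot> y))" using counit_left[OF assms(3)] by (simp add: sw_def)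
  also have "\<dots> = sw C c (\<lambda>x y. \<epsilon> x \<odot>\<^bsub>X\<^esub> f y)"
    using assms by (simp add: sw_linear[OF _ assms(1)] vspace_C scale_closed linear_map_scale[OF assms(1)] cong: sw_cong)
  finally show ?thesis by simp
qed

lemma sw_counit_right:
  assumes "linear_map C X f" "vspace X" "c \<in> carrier C"
  shows "sw C c (\<lambda>x y. \<epsilon> y \<odot>\<^bsub>X\<^esub> f x) = f c"
proof -
  have "f c = f (sw C c (\<lambda>x y. \<epsilon> y \<odot> x))" using counit_right[OF assms(3)] by (simp add: sw_def)
  also have "\<dots> = sw C c (\<lambda>x y. \<epsilon> y \<odot>\<^bsub>X\<^esub> f x)"
    using assms by (simp add: sw_linear[OF _ assms(1)] vspace_C scale_closed linear_map_scale[OF assms(1)] cong: sw_cong)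
  finally show ?thesis by simp
qed

end
declare coalgebra.vspace_C [lin] coalgebra.comult_closed [lin] coalgebra.sw_closed [lin]
  coalgebra.linear_map_sw_inner [lin] coalgebra.linear_map_sw_outer [lin]

context algebra
begin

lemma mult_closed: "x \<in> carrier A \<Longrightarrow> y \<in> carrier A \<Longrightarrow> x \<cdot> y \<in> carrier A"
  using bilinear_mult by (rule bilinear_map_closed)

lemmas linear_map_mult_left = bilinear_map_comp_left[OF bilinear_mult]
lemmas linear_map_mult_right = bilinear_map_comp_right[OF bilinear_mult]

lemma mult_scale_left:
  "x \<in> carrier A \<Longrightarrow> y \<in> carrier A \<Longrightarrow> (c \<odot> x) \<cdot> y = c \<odot> (x \<cdot> y)"
  using bilinear_mult by (auto simp: bilinear_map_def linear_map_def)

lemma mult_scale_right: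
  "x \<in> carrier A \<Longrightarrow> y \<in> carrier A \<Longrightarrow> x \<cdot> (c \<odot> y) = c \<odot> (x \<cdot> y)"
  using bilinear_mult by (auto simp: bilinear_map_def linear_map_def)

end

declare algebra.mult_closed [lin] algebra.one_closed [lin]
  algebra.linear_map_mult_left [lin] algebra.linear_map_mult_right [lin]

lemma (in coalgebra) linear_map_counit: "linear_map V C t \<Longrightarrow> linear_map V ground (\<lambda>x. \<epsilon> (t x))"
  by (rule linear_map_comp[OF linear_counit])

declare coalgebra.linear_map_counit [lin] vspace.scale_closed [lin]

lemma (in bialgebra) sw_mult:
  assumes "bilinear_map B B X f" "vspace X" "x \<in> carrier B" "y \<in> carrier B"
  shows "sw B (x \<cdot> y) f = sw B x (\<lambda>x1 x2. sw B y (\<lambda>y1 y2. f (x1 \<cdot> y1) (x2 \<cdot> y2)))"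
proof -
  have "sw B (x \<cdot> y) f = tlift B B f (sw B x (\<lambda>x1 x2. sw B y (\<lambda>y1 y2. (x1 \<cdot> y1) \<otimes>\<^bsub>B,B\<^esub> (x2 \<cdot> y2))))"
    unfolding sw_tlift[of B "x \<cdot> y"] using comult_mult[OF assms(3,4)] by (simp add: sw_def)
  also have "\<dots> = sw B x (\<lambda>x1 x2. sw B y (\<lambda>y1 y2. f (x1 \<cdot> y1) (x2 \<cdot> y2)))"
    using assms
    by (simp add: sw_linear[OF _ linear_map_tlift[OF vspace_C vspace_C assms(2,1)]]
        sw_closed vspace_C vspace_tensor pure_tensor_closed mult_closed
        tlift_pure[OF vspace_C vspace_C assms(2,1)] cong: sw_cong)
  finally show ?thesis .
qed

lemma (in bialgebra) sw_one:
  assumes "bilinear_map B B X f" "vspace X"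
  shows "sw B \<one> f = f \<one> \<one>"
  unfolding sw_tlift comult_one by (simp add: tlift_pure[OF vspace_C vspace_C assms(2,1)] one_closed)

lemma sw_coalgebra_map:
  assumes C: "coalgebra C" and D: "coalgebra D" and r: "coalgebra_map C D r"
    and f: "bilinear_map D D X f" "vspace X" and c: "c \<in> carrier C"
  shows "sw D (r c) f = sw C c (\<lambda>x y. f (r x) (r y))"
proof -
  have "linear_map C D r" using r by (simp add: coalgebra_map_def)
  note rc = linear_map_closed[OF this]
  note D' = coalgebra.vspace_C[OF D]
  have "sw D (r c) f = tlift D D f (sw C c (\<lambda>x y. r x \<otimes>\<^bsub>D,D\<^esub> r y))"
    unfolding sw_tlift[of D] using r c by (simp add: sw_def coalgebra_map_def)
  also have "\<dots> = sw C c (\<lambda>x y. f (r x) (r y))"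
    using c by (simp add: coalgebra.sw_linear[OF C _ linear_map_tlift[OF D' D' f(2,1)]]
        f(2) D' rc vspace_tensor pure_tensor_closed tlift_pure[OF D' D' f(2,1)] cong: coalgebra.sw_simp_cong[OF C])
  finally show ?thesis .
qed


lemma (in coalgebra) sw_scale_right:
  assumes "vspace X" "c \<in> carrier C" "\<And>x y. x \<in> carrier C \<Longrightarrow> y \<in> carrier C \<Longrightarrow> f x y \<in> carrier X"
  shows "sw C c (\<lambda>x y. k \<odot>\<^bsub>X\<^esub> f x y) = k \<odot>\<^bsub>X\<^esub> sw C c f"
  using sw_linear[of c X X "\<lambda>x. k \<odot>\<^bsub>X\<^esub> x" f] assms by (simp add: lin)

declare coalgebra.sw_scale_right [lin] coalgebra.sw_counit_left [lin] coalgebra.sw_counit_right [lin]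
  pure_tensor_scale_left [lin] pure_tensor_scale_right [lin]
  algebra.mult_scale_left [lin] algebra.mult_scale_right [lin]


section \<open>The tensor product of two coalgebras\<close>

text \<open>
  The products carry their own records, whereas \<open>tensor A H\<close> is a plain vector space.  Tensors
  and linear maps depend on the carrier and the scaling alone, so those records may be replaced by
  \<open>tensor A H\<close>.
\<close>

context
  fixes E :: "('k::field, 'v::ab_group_add, 'm) vspace_scheme"
    and T :: "('k::field, 'v::ab_group_add, 'n) vspace_scheme"
  assumes same: "carrier E = carrier T" "scale E = scale T"
begin

lemma linear_map_same_left: "linear_map E X f \<longleftrightarrow> linear_map T X f"
  and linear_map_same_right: "linear_map X E f' \<longleftrightarrow> linear_map X T f'"
  by (simp_all add: linear_map_def same)

lemma pure_tensor_same: "x \<otimes>\<^bsub>E,E\<^esub> y = x \<otimes>\<^bsub>T,T\<^esub> y"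
  by (simp add: pure_tensor_def bilinear_map_def linear_map_def same)

lemma tensor_rep_same: "tensor_rep E E t = tensor_rep T T t"
  by (simp add: tensor_rep_def same pure_tensor_same)

end

lemma tensor_counit_tlift: "tensor_counit C D = tlift C D (\<lambda>c d. \<epsilon>\<^bsub>C\<^esub> c * \<epsilon>\<^bsub>D\<^esub> d)"
  by (simp add: fun_eq_iff tensor_counit_def tlift_def)

lemma tensor_comult_tlift:
  "tensor_comult C D = tlift C D (\<lambda>c d. sw C c (\<lambda>c1 c2. sw D d (\<lambda>d1 d2.
     (c1 \<otimes>\<^bsub>C,D\<^esub> d1) \<otimes>\<^bsub>tensor C D,tensor C D\<^esub> (c2 \<otimes>\<^bsub>C,D\<^esub> d2))))"
  by (simp add: fun_eq_iff tensor_comult_def tlift_def sw_def)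

locale coalgebra_pair = C: coalgebra C + D: coalgebra D
  for C :: "('k::field, 'v::ab_group_add, 'm) bialgebra_scheme"
    and D :: "('k, 'w::ab_group_add, 'n) bialgebra_scheme"
begin

abbreviation "T \<equiv> tensor C D"

lemmas pair_simps = lin C.coalgebra_axioms D.coalgebra_axioms

text \<open>
  The projections \<open>id \<otimes> \<epsilon>\<close> and \<open>\<epsilon> \<otimes> id\<close>.
\<close>

definition fst_proj :: "('k, 'v, 'w) tensor \<Rightarrow> 'v" where
  "fst_proj = tlift C D (\<lambda>c d. \<epsilon>\<^bsub>D\<^esub> d \<odot>\<^bsub>C\<^esub> c)"

definition snd_proj :: "('k, 'v, 'w) tensor \<Rightarrow> 'w" where
  "snd_proj = tlift C D (\<lambda>c d. \<epsilon>\<^bsub>C\<^esub> c \<odot>\<^bsub>D\<^esub> d)"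

lemma linear_fst_proj: "linear_map T C fst_proj"
  unfolding fst_proj_def by (simp add: pair_simps linear_map_tlift)

lemma linear_snd_proj: "linear_map T D snd_proj"
  unfolding snd_proj_def by (simp add: pair_simps linear_map_tlift)

lemma fst_proj_pure: "c \<in> carrier C \<Longrightarrow> d \<in> carrier D \<Longrightarrow> fst_proj (c \<otimes>\<^bsub>C,D\<^esub> d) = \<epsilon>\<^bsub>D\<^esub> d \<odot>\<^bsub>C\<^esub> c"
  unfolding fst_proj_def by (simp add: pair_simps tlift_pure[of _ _ C])

lemma snd_proj_pure: "c \<in> carrier C \<Longrightarrow> d \<in> carrier D \<Longrightarrow> snd_proj (c \<otimes>\<^bsub>C,D\<^esub> d) = \<epsilon>\<^bsub>C\<^esub> c \<odot>\<^bsub>D\<^esub> d"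
  unfolding snd_proj_def by (simp add: pair_simps tlift_pure[of _ _ D])

lemmas proj_simps = pair_simps fst_proj_pure snd_proj_pure
  linear_map_comp[OF linear_fst_proj] linear_map_comp[OF linear_snd_proj]
  linear_map_closed[OF linear_fst_proj] linear_map_closed[OF linear_snd_proj]

lemma linear_tensor_comult: "linear_map T (tensor T T) (tensor_comult C D)"
  unfolding tensor_comult_tlift by (simp add: pair_simps linear_map_tlift)

lemma linear_tensor_counit: "linear_map T ground (tensor_counit C D)"
  unfolding tensor_counit_tlift by (simp add: pair_simps linear_map_tlift)

lemma tensor_comult_pure:
  assumes "c \<in> carrier C" "d \<in> carrier D"
  shows "tensor_comult C D (c \<otimes>\<^bsub>C,D\<^esub> d) = sw C c (\<lambda>c1 c2. sw D d (\<lambda>d1 d2.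
     (c1 \<otimes>\<^bsub>C,D\<^esub> d1) \<otimes>\<^bsub>T,T\<^esub> (c2 \<otimes>\<^bsub>C,D\<^esub> d2)))"
  unfolding tensor_comult_tlift using assms by (simp add: pair_simps tlift_pure[of _ _ "tensor T T"])

lemma tensor_counit_pure:
  assumes "c \<in> carrier C" "d \<in> carrier D"
  shows "tensor_counit C D (c \<otimes>\<^bsub>C,D\<^esub> d) = \<epsilon>\<^bsub>C\<^esub> c * \<epsilon>\<^bsub>D\<^esub> d"
  unfolding tensor_counit_tlift using assms by (simp add: pair_simps tlift_pure[of _ _ ground])

lemma tlift_comult_pure:
  assumes "bilinear_map T T X f" "vspace X" "c \<in> carrier C" "d \<in> carrier D"
  shows "tlift T T f (tensor_comult C D (c \<otimes>\<^bsub>C,D\<^esub> d))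
    = sw C c (\<lambda>c1 c2. sw D d (\<lambda>d1 d2. f (c1 \<otimes>\<^bsub>C,D\<^esub> d1) (c2 \<otimes>\<^bsub>C,D\<^esub> d2)))"
proof -
  note g = linear_map_tlift[OF vspace_tensor vspace_tensor assms(2,1)]
  show ?thesis
    using assms(2-) by (simp add: tensor_comult_pure C.sw_linear[OF _ g] D.sw_linear[OF _ g] pair_simps
        tlift_pure[OF _ _ assms(2,1)] del: bilinear_map_iff cong: coalgebra.sw_simp_cong)
qed

text \<open>
  Identities about \<open>\<Delta>\<close> on \<open>C \<otimes> D\<close> are checked on pure tensors, where \<open>\<Delta>\<close> is explicit.
\<close>

lemma tlift_comult_ext:
  assumes "bilinear_map T T X f" "vspace X" "linear_map T X g"
    and "\<And>c d. c \<in> carrier C \<Longrightarrow> d \<in> carrier D \<Longrightarrow>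
      sw C c (\<lambda>c1 c2. sw D d (\<lambda>d1 d2. f (c1 \<otimes>\<^bsub>C,D\<^esub> d1) (c2 \<otimes>\<^bsub>C,D\<^esub> d2))) = g (c \<otimes>\<^bsub>C,D\<^esub> d)"
    and "t \<in> carrier T"
  shows "tlift T T f (tensor_comult C D t) = g t"
  by (rule tensor_unique[OF C.vspace_C D.vspace_C assms(2) _ assms(3) _ assms(5)])
    (use assms in \<open>simp_all add: linear_map_tlift_outer linear_tensor_comult vspace_tensor tlift_comult_pure\<close>)

text \<open>
  In \<open>\<Delta>(c \<otimes> d) = (c\<^sub>1 \<otimes> d\<^sub>1) \<otimes> (c\<^sub>2 \<otimes> d\<^sub>2)\<close> the projections apply a counit to one leg of \<open>c\<close> and to
  one leg of \<open>d\<close>.  It does not matter which leg, so the tensor is recovered from its coproduct in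
  two different ways; their equality is the source of cocentrality.
\<close>

lemma tensor_as_fst_snd:
  assumes "t \<in> carrier T"
  shows "tlift T T (\<lambda>x y. fst_proj x \<otimes>\<^bsub>C,D\<^esub> snd_proj y) (tensor_comult C D t) = t"
  by (rule tlift_comult_ext[where X = T and g = "\<lambda>t. t"])
    (simp_all add: assms proj_simps cong: coalgebra.sw_simp_cong)

lemma tensor_as_snd_fst:
  assumes "t \<in> carrier T"
  shows "tlift T T (\<lambda>x y. fst_proj y \<otimes>\<^bsub>C,D\<^esub> snd_proj x) (tensor_comult C D t) = t"
  by (rule tlift_comult_ext[where X = T and g = "\<lambda>t. t"])
    (simp_all add: assms proj_simps cong: coalgebra.sw_simp_cong)

lemma fst_proj_comult:
  assumes "t \<in> carrier T"
  shows "tlift T T (\<lambda>x y. fst_proj x \<otimes>\<^bsub>C,C\<^esub> fst_proj y) (tensor_comult C D t) = \<Delta>\<^bsub>C\<^esub> (fst_proj t)"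
  by (rule tlift_comult_ext[where X = "tensor C C"])
    (simp_all add: assms proj_simps C.comult_sw[symmetric] linear_map_comp[OF C.linear_comult]
      linear_map_scale[OF C.linear_comult] cong: coalgebra.sw_simp_cong)

lemma snd_proj_comult:
  assumes "t \<in> carrier T"
  shows "tlift T T (\<lambda>x y. snd_proj x \<otimes>\<^bsub>D,D\<^esub> snd_proj y) (tensor_comult C D t) = \<Delta>\<^bsub>D\<^esub> (snd_proj t)"
  by (rule tlift_comult_ext[where X = "tensor D D"])
    (simp_all add: assms proj_simps D.comult_sw[symmetric] linear_map_comp[OF D.linear_comult]
      linear_map_scale[OF D.linear_comult] cong: coalgebra.sw_simp_cong)

lemma counit_proj:
  assumes "t \<in> carrier T"
  shows "\<epsilon>\<^bsub>C\<^esub> (fst_proj t) = tensor_counit C D t" "\<epsilon>\<^bsub>D\<^esub> (snd_proj t) = tensor_counit C D t"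
  by (rule tensor_unique[where X = ground, OF C.vspace_C D.vspace_C vspace_ground _ linear_tensor_counit _ assms];
      simp add: proj_simps tensor_counit_pure linear_map_scale[OF C.linear_counit] linear_map_scale[OF D.linear_counit])+

end

text \<open>A coalgebra map into a tensor product is determined by its two components.\<close>

locale coalgebra_pair_map = coalgebra_pair C D + B: coalgebra B
  for B :: "('k::field, 'u::ab_group_add, 'l) bialgebra_scheme"
    and C :: "('k, 'v::ab_group_add, 'm) bialgebra_scheme"
    and D :: "('k, 'w::ab_group_add, 'n) bialgebra_scheme" +
  fixes j :: "'u \<Rightarrow> ('k, 'v, 'w) tensor"
  assumes linear_j: "linear_map B T j"
    and comult_j: "b \<in> carrier B \<Longrightarrow> tensor_comult C D (j b) = sw B b (\<lambda>x y. j x \<otimes>\<^bsub>T,T\<^esub> j y)"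
    and counit_j: "b \<in> carrier B \<Longrightarrow> tensor_counit C D (j b) = \<epsilon>\<^bsub>B\<^esub> b"
begin

definition fst_part :: "'u \<Rightarrow> 'v" where "fst_part b = fst_proj (j b)"
definition snd_part :: "'u \<Rightarrow> 'w" where "snd_part b = snd_proj (j b)"

lemmas j_closed = linear_map_closed[OF linear_j]

lemma linear_fst_part: "linear_map B C fst_part"
  unfolding fst_part_def[abs_def] by (simp add: proj_simps linear_j)

lemma linear_snd_part: "linear_map B D snd_part"
  unfolding snd_part_def[abs_def] by (simp add: proj_simps linear_j)

lemma tlift_comult_j:
  assumes "bilinear_map T T X f" "vspace X" "b \<in> carrier B"
  shows "tlift T T f (tensor_comult C D (j b)) = sw B b (\<lambda>x y. f (j x) (j y))"
proof -
  note g = linear_map_tlift[OF vspace_tensor vspace_tensor assms(2,1)]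
  show ?thesis
    using assms(2-) by (simp add: comult_j B.sw_linear[OF _ g] pair_simps B.coalgebra_axioms j_closed
        tlift_pure[OF _ _ assms(2,1)] del: bilinear_map_iff cong: coalgebra.sw_simp_cong)
qed

lemma j_fst_snd: "b \<in> carrier B \<Longrightarrow> j b = sw B b (\<lambda>x y. fst_part x \<otimes>\<^bsub>C,D\<^esub> snd_part y)"
  using tlift_comult_j[of T "\<lambda>x y. fst_proj x \<otimes>\<^bsub>C,D\<^esub> snd_proj y" b]
  by (simp add: proj_simps tensor_as_fst_snd j_closed fst_part_def snd_part_def)

lemma j_snd_fst: "b \<in> carrier B \<Longrightarrow> j b = sw B b (\<lambda>x y. fst_part y \<otimes>\<^bsub>C,D\<^esub> snd_part x)"
  using tlift_comult_j[of T "\<lambda>x y. fst_proj y \<otimes>\<^bsub>C,D\<^esub> snd_proj x" b]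
  by (simp add: proj_simps tensor_as_snd_fst j_closed fst_part_def snd_part_def)

lemma coalgebra_map_fst_part: "coalgebra_map B C fst_part"
  unfolding coalgebra_map_def
  using tlift_comult_j[of "tensor C C" "\<lambda>x y. fst_proj x \<otimes>\<^bsub>C,C\<^esub> fst_proj y"]
  by (simp add: linear_fst_part proj_simps fst_proj_comult j_closed counit_proj counit_j
      fst_part_def sw_def[symmetric])

lemma coalgebra_map_snd_part: "coalgebra_map B D snd_part"
  unfolding coalgebra_map_def
  using tlift_comult_j[of "tensor D D" "\<lambda>x y. snd_proj x \<otimes>\<^bsub>D,D\<^esub> snd_proj y"]
  by (simp add: linear_snd_part proj_simps snd_proj_comult j_closed counit_proj counit_j
      snd_part_def sw_def[symmetric])

end

section \<open>Cancelling antipodes\<close>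

lemma is_antipode_antipode: "hopf_algebra A \<Longrightarrow> is_antipode A (antipode A)"
  unfolding antipode_def by (rule someI_ex[OF hopf_algebra.ex_antipode])

locale coalgebra_to_hopf = H: coalgebra H + A: hopf_algebra A
  for H :: "('k::field, 'h::ab_group_add, 'm) bialgebra_scheme"
    and A :: "('k, 'a::ab_group_add, 'n) bialgebra_scheme" +
  fixes r :: "'h \<Rightarrow> 'a"
  assumes r: "coalgebra_map H A r"
begin

abbreviation "S \<equiv> antipode A"

lemma linear_r: "linear_map H A r"
  using r by (simp add: coalgebra_map_def)

lemma linear_S: "linear_map A A S"
  using is_antipode_antipode[OF A.hopf_algebra_axioms] by (simp add: is_antipode_def)

lemma counit_r: "h \<in> carrier H \<Longrightarrow> \<epsilon>\<^bsub>A\<^esub> (r h) = \<epsilon>\<^bsub>H\<^esub> h"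
  using r by (simp add: coalgebra_map_def)

lemmas r_simps = lin H.coalgebra_axioms A.coalgebra_axioms A.algebra_axioms A.vspace_axioms
  linear_map_comp[OF linear_r] linear_map_comp[OF linear_S] linear_r linear_S
  linear_map_closed[OF linear_r] linear_map_closed[OF linear_S] counit_r

lemmas sw_r = sw_coalgebra_map[OF H.coalgebra_axioms A.coalgebra_axioms r]

lemma antipode_r:
  assumes "h \<in> carrier H"
  shows "sw H h (\<lambda>x y. S (r x) \<cdot>\<^bsub>A\<^esub> r y) = \<epsilon>\<^bsub>H\<^esub> h \<odot>\<^bsub>A\<^esub> \<one>\<^bsub>A\<^esub>"
    and "sw H h (\<lambda>x y. r x \<cdot>\<^bsub>A\<^esub> S (r y)) = \<epsilon>\<^bsub>H\<^esub> h \<odot>\<^bsub>A\<^esub> \<one>\<^bsub>A\<^esub>"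
proof -
  have S: "is_antipode A S" by (rule is_antipode_antipode[OF A.hopf_algebra_axioms])
  have "sw A (r h) (\<lambda>x y. S x \<cdot>\<^bsub>A\<^esub> y) = \<epsilon>\<^bsub>H\<^esub> h \<odot>\<^bsub>A\<^esub> \<one>\<^bsub>A\<^esub>"
    "sw A (r h) (\<lambda>x y. x \<cdot>\<^bsub>A\<^esub> S y) = \<epsilon>\<^bsub>H\<^esub> h \<odot>\<^bsub>A\<^esub> \<one>\<^bsub>A\<^esub>"
    using S assms by (simp_all add: is_antipode_def sw_def r_simps)
  then show "sw H h (\<lambda>x y. S (r x) \<cdot>\<^bsub>A\<^esub> r y) = \<epsilon>\<^bsub>H\<^esub> h \<odot>\<^bsub>A\<^esub> \<one>\<^bsub>A\<^esub>"
    "sw H h (\<lambda>x y. r x \<cdot>\<^bsub>A\<^esub> S (r y)) = \<epsilon>\<^bsub>H\<^esub> h \<odot>\<^bsub>A\<^esub> \<one>\<^bsub>A\<^esub>"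
    by (simp_all add: sw_r[where X = A] assms r_simps)
qed

text \<open>
  Convolution of maps \<open>H \<rightarrow> A\<close> is associative with unit \<open>h \<mapsto> \<epsilon>(h) 1\<close>, so \<open>P * Q = 1\<close> implies
  \<open>(L * P) * Q = L\<close>.  It is used for \<open>r\<close> and \<open>S \<circ> r\<close> in both orders.
\<close>

lemma convolution_cancel:
  assumes L: "linear_map H A L" and P: "linear_map H A P" and Q: "linear_map H A Q"
    and PQ: "\<And>h. h \<in> carrier H \<Longrightarrow> sw H h (\<lambda>x y. P x \<cdot>\<^bsub>A\<^esub> Q y) = \<epsilon>\<^bsub>H\<^esub> h \<odot>\<^bsub>A\<^esub> \<one>\<^bsub>A\<^esub>"
    and h: "h \<in> carrier H"
  shows "sw H h (\<lambda>x y. sw H x (\<lambda>x1 x2. L x1 \<cdot>\<^bsub>A\<^esub> P x2) \<cdot>\<^bsub>A\<^esub> Q y) = L h"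
proof -
  note s = r_simps L P Q linear_map_closed[OF L] linear_map_closed[OF P] linear_map_closed[OF Q]
    linear_map_comp[OF L] linear_map_comp[OF P] linear_map_comp[OF Q]
  have "sw H h (\<lambda>x y. sw H x (\<lambda>x1 x2. L x1 \<cdot>\<^bsub>A\<^esub> P x2) \<cdot>\<^bsub>A\<^esub> Q y)
      = sw H h (\<lambda>x y. sw H x (\<lambda>x1 x2. L x1 \<cdot>\<^bsub>A\<^esub> (P x2 \<cdot>\<^bsub>A\<^esub> Q y)))"
    using h by (simp add: H.sw_linear[where X = A and Y = A and g = "\<lambda>z. z \<cdot>\<^bsub>A\<^esub> Q y" for y] s A.mult_assoc
        cong: coalgebra.sw_simp_cong)
  also have "\<dots> = sw H h (\<lambda>x y. sw H y (\<lambda>y1 y2. L x \<cdot>\<^bsub>A\<^esub> (P y1 \<cdot>\<^bsub>A\<^esub> Q y2)))"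
    by (rule H.sw_coassoc[where X = A]) (use h in \<open>simp_all add: s\<close>)
  also have "\<dots> = sw H h (\<lambda>x y. L x \<cdot>\<^bsub>A\<^esub> sw H y (\<lambda>y1 y2. P y1 \<cdot>\<^bsub>A\<^esub> Q y2))"
    using h by (simp add: H.sw_linear[where X = A and Y = A and g = "\<lambda>z. L x \<cdot>\<^bsub>A\<^esub> z" for x] s
        cong: coalgebra.sw_simp_cong)
  also have "\<dots> = L h"
    using h by (simp add: PQ s A.mult_one cong: coalgebra.sw_simp_cong)
  finally show ?thesis .
qed

end


section \<open>Multiplication in bicrossed and smash products\<close>

locale bicrossed_and_smash = matched_pair A H lact ract + H': hopf_algebra H'
  for A :: "('k::field, 'a::ab_group_add) bialgebra"
    and H :: "('k, 'h::ab_group_add) bialgebra"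
    and H' :: "('k, 'g::ab_group_add) bialgebra"
    and lact :: "'h \<Rightarrow> 'a \<Rightarrow> 'a"  (infixr "\<triangleright>" 80)
    and ract :: "'h \<Rightarrow> 'a \<Rightarrow> 'h"  (infixl "\<triangleleft>" 80) +
  fixes lact' :: "'g \<Rightarrow> 'a \<Rightarrow> 'a"  (infixr "\<triangleright>''" 80)
  assumes algebra': "left_module_algebra H' A (\<triangleright>')"
    and coalgebra': "left_module_coalgebra H' A (\<triangleright>')"
begin

abbreviation "E \<equiv> bicrossed_product A H (\<triangleright>) (\<triangleleft>)"
abbreviation "E' \<equiv> smash_product A H' (\<triangleright>')"

sublocale AH: coalgebra_pair A H by unfold_locales
sublocale AH': coalgebra_pair A H' by unfold_locales

lemma E_carrier [simp]: "carrier E = carrier (tensor A H)" "scale E = scale (tensor A H)"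
  "comult E = tensor_comult A H" "counit E = tensor_counit A H"
  "\<one>\<^bsub>E\<^esub> = \<one>\<^bsub>A\<^esub> \<otimes>\<^bsub>A,H\<^esub> \<one>\<^bsub>H\<^esub>"
  by (simp_all add: bicrossed_product_def)

lemma E'_carrier [simp]: "carrier E' = carrier (tensor A H')" "scale E' = scale (tensor A H')"
  "comult E' = tensor_comult A H'" "counit E' = tensor_counit A H'"
  "\<one>\<^bsub>E'\<^esub> = \<one>\<^bsub>A\<^esub> \<otimes>\<^bsub>A,H'\<^esub> \<one>\<^bsub>H'\<^esub>"
  by (simp_all add: smash_product_def)

lemmas same_E = E_carrier(1,2) and same_E' = E'_carrier(1,2)

lemma linear_map_E_E': "linear_map E E' f \<longleftrightarrow> linear_map (tensor A H) (tensor A H') f"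
  by (simp add: linear_map_same_left[OF same_E] linear_map_same_right[OF same_E'])

lemma bilinear_lact: "bilinear_map H A A (\<triangleright>)"
  using lact_module by (simp add: left_module_def)

lemma bilinear_ract: "bilinear_map H A H (\<triangleleft>)"
  using ract_module by (simp add: right_module_def)

lemma bilinear_lact': "bilinear_map H' A A (\<triangleright>')"
  using algebra' by (simp add: left_module_algebra_def left_module_def)

lemmas action_simps = lin
  A.vspace_axioms A.algebra_axioms A.coalgebra_axioms H.vspace_axioms H.algebra_axioms H.coalgebra_axioms
  H'.vspace_axioms H'.algebra_axioms H'.coalgebra_axioms
  bilinear_map_comp_left[OF bilinear_lact] bilinear_map_comp_right[OF bilinear_lact]
  bilinear_map_comp_left[OF bilinear_ract] bilinear_map_comp_right[OF bilinear_ract]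
  bilinear_map_comp_left[OF bilinear_lact'] bilinear_map_comp_right[OF bilinear_lact']
  bilinear_map_closed[OF bilinear_lact] bilinear_map_closed[OF bilinear_ract]
  bilinear_map_closed[OF bilinear_lact']
  bilinear_map_scale_left[OF bilinear_lact] bilinear_map_scale_right[OF bilinear_lact]
  bilinear_map_scale_left[OF bilinear_ract] bilinear_map_scale_right[OF bilinear_ract]
  bilinear_map_scale_left[OF bilinear_lact'] bilinear_map_scale_right[OF bilinear_lact']
  scale_mult

text \<open>
  The opposite orientation, which merges scalars, would loop with \<open>scale_mult\<close>.
\<close>

declare A.vs.scale_scale [simp del] H.vs.scale_scale [simp del] H'.vs.scale_scale [simp del]

lemma E_mult: "x \<cdot>\<^bsub>E\<^esub> y = tlift A H (\<lambda>a h. tlift A H (\<lambda>c g. sw H h (\<lambda>h1 h2. sw A c (\<lambda>c1 c2.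
    (a \<cdot>\<^bsub>A\<^esub> (h1 \<triangleright> c1)) \<otimes>\<^bsub>A,H\<^esub> ((h2 \<triangleleft> c2) \<cdot>\<^bsub>H\<^esub> g)))) y) x"
  by (simp add: bicrossed_product_def tlift_def sw_def)

lemma E'_mult: "x \<cdot>\<^bsub>E'\<^esub> y = tlift A H' (\<lambda>a h. tlift A H' (\<lambda>c g. sw H' h (\<lambda>h1 h2.
    (a \<cdot>\<^bsub>A\<^esub> (h1 \<triangleright>' c)) \<otimes>\<^bsub>A,H'\<^esub> (h2 \<cdot>\<^bsub>H'\<^esub> g))) y) x"
  by (simp add: smash_product_def tlift_def sw_def)

lemma bilinear_E_mult: "bilinear_map (tensor A H) (tensor A H) (tensor A H) (mult E)"
  unfolding E_mult[abs_def] by (simp add: action_simps)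

lemma bilinear_E'_mult: "bilinear_map (tensor A H') (tensor A H') (tensor A H') (mult E')"
  unfolding E'_mult[abs_def] by (simp add: action_simps)

lemmas mult_simps = action_simps
  bilinear_map_comp_left[OF bilinear_E_mult] bilinear_map_comp_right[OF bilinear_E_mult]
  bilinear_map_comp_left[OF bilinear_E'_mult] bilinear_map_comp_right[OF bilinear_E'_mult]
  bilinear_map_closed[OF bilinear_E_mult] bilinear_map_closed[OF bilinear_E'_mult]

lemma E_mult_pure:
  assumes "a \<in> carrier A" "c \<in> carrier A" "h \<in> carrier H" "g \<in> carrier H"
  shows "(a \<otimes>\<^bsub>A,H\<^esub> h) \<cdot>\<^bsub>E\<^esub> (c \<otimes>\<^bsub>A,H\<^esub> g) = sw H h (\<lambda>h1 h2. sw A c (\<lambda>c1 c2.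
    (a \<cdot>\<^bsub>A\<^esub> (h1 \<triangleright> c1)) \<otimes>\<^bsub>A,H\<^esub> ((h2 \<triangleleft> c2) \<cdot>\<^bsub>H\<^esub> g)))"
  unfolding E_mult using assms by (simp add: action_simps tlift_pure[where X = "tensor A H"])

lemma E'_mult_pure:
  assumes "a \<in> carrier A" "c \<in> carrier A" "h \<in> carrier H'" "g \<in> carrier H'"
  shows "(a \<otimes>\<^bsub>A,H'\<^esub> h) \<cdot>\<^bsub>E'\<^esub> (c \<otimes>\<^bsub>A,H'\<^esub> g) = sw H' h (\<lambda>h1 h2.
    (a \<cdot>\<^bsub>A\<^esub> (h1 \<triangleright>' c)) \<otimes>\<^bsub>A,H'\<^esub> (h2 \<cdot>\<^bsub>H'\<^esub> g))"
  unfolding E'_mult using assms by (simp add: action_simps tlift_pure[where X = "tensor A H'"])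

lemma lact_one_left: "a \<in> carrier A \<Longrightarrow> \<one>\<^bsub>H\<^esub> \<triangleright> a = a"
  using lact_module by (simp add: left_module_def)

lemma ract_one_right: "h \<in> carrier H \<Longrightarrow> h \<triangleleft> \<one>\<^bsub>A\<^esub> = h"
  using ract_module by (simp add: right_module_def)

lemma lact'_one_left: "a \<in> carrier A \<Longrightarrow> \<one>\<^bsub>H'\<^esub> \<triangleright>' a = a"
  using algebra' by (simp add: left_module_algebra_def left_module_def)

lemma lact'_one: "h \<in> carrier H' \<Longrightarrow> h \<triangleright>' \<one>\<^bsub>A\<^esub> = \<epsilon>\<^bsub>H'\<^esub> h \<odot>\<^bsub>A\<^esub> \<one>\<^bsub>A\<^esub>"
  using algebra' by (simp add: left_module_algebra_def)

lemma lact'_mult: "h \<in> carrier H' \<Longrightarrow> a \<in> carrier A \<Longrightarrow> b \<in> carrier A \<Longrightarrow>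
    h \<triangleright>' (a \<cdot>\<^bsub>A\<^esub> b) = sw H' h (\<lambda>h1 h2. (h1 \<triangleright>' a) \<cdot>\<^bsub>A\<^esub> (h2 \<triangleright>' b))"
  using algebra' by (simp add: left_module_algebra_def sw_def)

lemma counit_lact: "h \<in> carrier H \<Longrightarrow> a \<in> carrier A \<Longrightarrow> \<epsilon>\<^bsub>A\<^esub> (h \<triangleright> a) = \<epsilon>\<^bsub>H\<^esub> h * \<epsilon>\<^bsub>A\<^esub> a"
  using lact_coalgebra_map by (simp add: coalgebra_map2_def)

lemma counit_lact': "h \<in> carrier H' \<Longrightarrow> a \<in> carrier A \<Longrightarrow> \<epsilon>\<^bsub>A\<^esub> (h \<triangleright>' a) = \<epsilon>\<^bsub>H'\<^esub> h * \<epsilon>\<^bsub>A\<^esub> a"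
  using coalgebra' by (simp add: left_module_coalgebra_def coalgebra_map2_def)

lemmas unit_simps = lact_one_left ract_one_right lact'_one_left lact_one lact'_one one_ract
  counit_lact counit_lact' A.one_mult A.mult_one H.one_mult H.mult_one H'.one_mult H'.mult_one
  A.counit_one H.counit_one H'.counit_one A.counit_mult H.counit_mult H'.counit_mult

lemma E_left_mult_pure:
  assumes "a \<in> carrier A" "c \<in> carrier A" "g \<in> carrier H"
  shows "(a \<otimes>\<^bsub>A,H\<^esub> \<one>\<^bsub>H\<^esub>) \<cdot>\<^bsub>E\<^esub> (c \<otimes>\<^bsub>A,H\<^esub> g) = (a \<cdot>\<^bsub>A\<^esub> c) \<otimes>\<^bsub>A,H\<^esub> g"
  using assms by (simp add: E_mult_pure H.sw_one[where X = "tensor A H"] action_simps unit_simps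
      cong: coalgebra.sw_simp_cong)

lemma E'_left_mult_pure:
  assumes "a \<in> carrier A" "c \<in> carrier A" "g \<in> carrier H'"
  shows "(a \<otimes>\<^bsub>A,H'\<^esub> \<one>\<^bsub>H'\<^esub>) \<cdot>\<^bsub>E'\<^esub> (c \<otimes>\<^bsub>A,H'\<^esub> g) = (a \<cdot>\<^bsub>A\<^esub> c) \<otimes>\<^bsub>A,H'\<^esub> g"
  using assms by (simp add: E'_mult_pure H'.sw_one[where X = "tensor A H'"] action_simps unit_simps)

text \<open>
  \<open>\<epsilon> \<otimes> id\<close> turns left multiplication by \<open>a\<close> into the scalar \<open>\<epsilon>(a)\<close>; so every \<open>A\<close>-linear map
  descends along it.
\<close>

lemma snd_E_left_mult:
  assumes "a \<in> carrier A" "t \<in> carrier (tensor A H)"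
  shows "AH.snd_proj ((a \<otimes>\<^bsub>A,H\<^esub> \<one>\<^bsub>H\<^esub>) \<cdot>\<^bsub>E\<^esub> t) = \<epsilon>\<^bsub>A\<^esub> a \<odot>\<^bsub>H\<^esub> AH.snd_proj t"
  by (rule tensor_unique[where X = H, OF A.vspace_C H.vspace_C H.vspace_C _ _ _ assms(2)])
    (simp_all add: mult_simps AH.proj_simps assms(1) E_left_mult_pure unit_simps)

text \<open>
  \<open>\<epsilon> \<otimes> id\<close> is multiplicative on the smash product because \<open>\<triangleright>'\<close> is a coalgebra map:
  \<open>\<epsilon>(a (g\<^sub>1 \<triangleright>' c)) g\<^sub>2 = \<epsilon>(a) \<epsilon>(c) g\<close>.
\<close>

lemma snd_E'_mult:
  assumes "x \<in> carrier (tensor A H')" "y \<in> carrier (tensor A H')"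
  shows "AH'.snd_proj (x \<cdot>\<^bsub>E'\<^esub> y) = AH'.snd_proj x \<cdot>\<^bsub>H'\<^esub> AH'.snd_proj y"
proof (rule tensor_unique[where X = H', OF A.vspace_C H'.vspace_C H'.vspace_C _ _ _ assms(1)])
  fix a g assume ag: "a \<in> carrier A" "g \<in> carrier H'"
  show "AH'.snd_proj ((a \<otimes>\<^bsub>A,H'\<^esub> g) \<cdot>\<^bsub>E'\<^esub> y) = AH'.snd_proj (a \<otimes>\<^bsub>A,H'\<^esub> g) \<cdot>\<^bsub>H'\<^esub> AH'.snd_proj y"
    by (rule tensor_unique[where X = H', OF A.vspace_C H'.vspace_C H'.vspace_C _ _ _ assms(2)])
      (simp_all add: mult_simps AH'.proj_simps ag assms E'_mult_pure unit_simps
        H'.sw_linear[OF _ AH'.linear_snd_proj] cong: coalgebra.sw_simp_cong)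
qed (simp_all add: mult_simps AH'.proj_simps assms)

text \<open>
  \<open>id \<otimes> \<epsilon>\<close> need not be multiplicative, but in a product it sees the right-hand factor only through
  its own image.
\<close>

lemma fst_E'_mult:
  assumes "x \<in> carrier (tensor A H')" "y \<in> carrier (tensor A H')"
  shows "AH'.fst_proj (x \<cdot>\<^bsub>E'\<^esub> y) = tlift A H' (\<lambda>a g. a \<cdot>\<^bsub>A\<^esub> (g \<triangleright>' AH'.fst_proj y)) x"
proof (rule tensor_unique[where X = A, OF A.vspace_C H'.vspace_C A.vspace_C _ _ _ assms(1)])
  fix a g assume ag: "a \<in> carrier A" "g \<in> carrier H'"
  have "AH'.fst_proj ((a \<otimes>\<^bsub>A,H'\<^esub> g) \<cdot>\<^bsub>E'\<^esub> y) = a \<cdot>\<^bsub>A\<^esub> (g \<triangleright>' AH'.fst_proj y)"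
    by (rule tensor_unique[where X = A, OF A.vspace_C H'.vspace_C A.vspace_C _ _ _ assms(2)])
      (simp_all add: mult_simps AH'.proj_simps ag assms E'_mult_pure unit_simps
        H'.sw_linear[OF _ AH'.linear_fst_proj] cong: coalgebra.sw_simp_cong)
  then show "AH'.fst_proj ((a \<otimes>\<^bsub>A,H'\<^esub> g) \<cdot>\<^bsub>E'\<^esub> y)
      = tlift A H' (\<lambda>a g. a \<cdot>\<^bsub>A\<^esub> (g \<triangleright>' AH'.fst_proj y)) (a \<otimes>\<^bsub>A,H'\<^esub> g)"
    using ag assms by (simp add: tlift_pure[where X = A] mult_simps AH'.proj_simps)
qed (simp_all add: mult_simps AH'.proj_simps assms linear_map_tlift)

end

section \<open>From an isomorphism to the pair of maps\<close>

lemma linear_map_inv: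
  assumes "vspace V" "linear_map V W f" "bij_betw f (carrier V) (carrier W)"
  shows "linear_map W V (inv_into (carrier V) f)"
proof -
  interpret V: vspace V by fact
  let ?g = "inv_into (carrier V) f"
  have g: "?g y \<in> carrier V" "f (?g y) = y" if "y \<in> carrier W" for y
    using assms(3) that by (simp_all add: bij_betw_def inv_into_into f_inv_into_f)
  have uniq: "x = ?g y" if "x \<in> carrier V" "f x = y" for x y
    using assms(3) that by (auto simp: bij_betw_def)
  show ?thesis
    unfolding linear_map_def
    using g by (auto intro!: uniq[symmetric] V.add_closed V.scale_closed
        simp: linear_map_add[OF assms(2)] linear_map_scale[OF assms(2)])
qed

locale bicrossed_smash_iso = bicrossed_and_smash A H H' lact ract lact'
  for A :: "('k::field, 'a::ab_group_add) bialgebra"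
    and H :: "('k, 'h::ab_group_add) bialgebra"
    and H' :: "('k, 'g::ab_group_add) bialgebra"
    and lact :: "'h \<Rightarrow> 'a \<Rightarrow> 'a"  (infixr "\<triangleright>" 80)
    and ract :: "'h \<Rightarrow> 'a \<Rightarrow> 'h"  (infixl "\<triangleleft>" 80)
    and lact' :: "'g \<Rightarrow> 'a \<Rightarrow> 'a"  (infixr "\<triangleright>''" 80) +
  fixes \<psi> :: "('k, 'a, 'h) tensor \<Rightarrow> ('k, 'a, 'g) tensor"
  assumes iso: "hopf_iso E E' \<psi>"
    and left_linear: "left_linear A H H' E E' \<psi>"
begin

lemma linear_psi: "linear_map (tensor A H) (tensor A H') \<psi>"
  using left_linear by (simp add: left_linear_def linear_map_E_E')

lemma bij_psi: "bij_betw \<psi> (carrier (tensor A H)) (carrier (tensor A H'))"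
  using iso by (simp add: hopf_iso_def)

lemma psi_mult: "x \<in> carrier (tensor A H) \<Longrightarrow> y \<in> carrier (tensor A H) \<Longrightarrow>
    \<psi> (x \<cdot>\<^bsub>E\<^esub> y) = \<psi> x \<cdot>\<^bsub>E'\<^esub> \<psi> y"
  using iso by (simp add: hopf_iso_def hopf_hom_def algebra_map_def)

lemma psi_one: "\<psi> (\<one>\<^bsub>A\<^esub> \<otimes>\<^bsub>A,H\<^esub> \<one>\<^bsub>H\<^esub>) = \<one>\<^bsub>A\<^esub> \<otimes>\<^bsub>A,H'\<^esub> \<one>\<^bsub>H'\<^esub>"
  using iso by (simp add: hopf_iso_def hopf_hom_def algebra_map_def)

lemma psi_comult: "x \<in> carrier (tensor A H) \<Longrightarrow> tensor_comult A H' (\<psi> x)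
    = tlift (tensor A H) (tensor A H) (\<lambda>x y. \<psi> x \<otimes>\<^bsub>tensor A H',tensor A H'\<^esub> \<psi> y) (tensor_comult A H x)"
  using iso by (simp add: hopf_iso_def hopf_hom_def coalgebra_map_def sweedler_def tlift_def
      pure_tensor_same[OF same_E'] tensor_rep_same[OF same_E])

lemma psi_counit: "x \<in> carrier (tensor A H) \<Longrightarrow> tensor_counit A H' (\<psi> x) = tensor_counit A H x"
  using iso by (simp add: hopf_iso_def hopf_hom_def coalgebra_map_def)

lemma psi_left: "a \<in> carrier A \<Longrightarrow> x \<in> carrier (tensor A H) \<Longrightarrow>
    \<psi> ((a \<otimes>\<^bsub>A,H\<^esub> \<one>\<^bsub>H\<^esub>) \<cdot>\<^bsub>E\<^esub> x) = (a \<otimes>\<^bsub>A,H'\<^esub> \<one>\<^bsub>H'\<^esub>) \<cdot>\<^bsub>E'\<^esub> \<psi> x"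
  using left_linear by (simp add: left_linear_def)

lemmas psi_simps = mult_simps AH.proj_simps AH'.proj_simps
  linear_psi linear_map_comp[OF linear_psi] linear_map_closed[OF linear_psi]

text \<open>
  The restriction of \<open>\<psi>\<close> to \<open>H\<close>; by \<open>A\<close>-linearity it determines \<open>\<psi>\<close>.
\<close>

definition j :: "'h \<Rightarrow> ('k, 'a, 'g) tensor" where
  "j h = \<psi> (\<one>\<^bsub>A\<^esub> \<otimes>\<^bsub>A,H\<^esub> h)"

sublocale J: coalgebra_pair_map H A H' j
proof unfold_locales
  show "linear_map H (tensor A H') j" unfolding j_def[abs_def] by (simp add: psi_simps)
  fix b assume b: "b \<in> carrier H"
  show "tensor_comult A H' (j b) = sw H b (\<lambda>x y. j x \<otimes>\<^bsub>tensor A H',tensor A H'\<^esub> j y)"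
    unfolding j_def using b
    by (simp add: psi_simps psi_comult AH.tlift_comult_pure[where X = "tensor (tensor A H') (tensor A H')"]
        A.sw_one[where X = "tensor (tensor A H') (tensor A H')"])
  show "tensor_counit A H' (j b) = \<epsilon>\<^bsub>H\<^esub> b"
    unfolding j_def using b by (simp add: psi_simps psi_counit AH.tensor_counit_pure unit_simps)
qed

abbreviation "r \<equiv> J.fst_part"
abbreviation "v \<equiv> J.snd_part"

lemma j_one: "j \<one>\<^bsub>H\<^esub> = \<one>\<^bsub>A\<^esub> \<otimes>\<^bsub>A,H'\<^esub> \<one>\<^bsub>H'\<^esub>"
  by (simp add: j_def psi_one)

lemma r_one: "r \<one>\<^bsub>H\<^esub> = \<one>\<^bsub>A\<^esub>"
  by (simp add: J.fst_part_def j_one psi_simps unit_simps)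

lemma v_one: "v \<one>\<^bsub>H\<^esub> = \<one>\<^bsub>H'\<^esub>"
  by (simp add: J.snd_part_def j_one psi_simps unit_simps)

lemma psi_pure:
  assumes "a \<in> carrier A" "h \<in> carrier H"
  shows "\<psi> (a \<otimes>\<^bsub>A,H\<^esub> h) = (a \<otimes>\<^bsub>A,H'\<^esub> \<one>\<^bsub>H'\<^esub>) \<cdot>\<^bsub>E'\<^esub> j h"
  using psi_left[OF assms(1), of "\<one>\<^bsub>A\<^esub> \<otimes>\<^bsub>A,H\<^esub> h"] assms
  by (simp add: psi_simps E_left_mult_pure unit_simps j_def)

lemmas rv_simps = psi_simps J.linear_fst_part J.linear_snd_part
  linear_map_comp[OF J.linear_fst_part] linear_map_comp[OF J.linear_snd_part] linear_map_comp[OF J.linear_j]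
  linear_map_closed[OF J.linear_fst_part] linear_map_closed[OF J.linear_snd_part] J.j_closed

lemma fst_psi:
  assumes "a \<in> carrier A" "h \<in> carrier H"
  shows "AH'.fst_proj (\<psi> (a \<otimes>\<^bsub>A,H\<^esub> h)) = a \<cdot>\<^bsub>A\<^esub> r h"
  using assms by (simp add: psi_pure fst_E'_mult rv_simps unit_simps tlift_pure[where X = A]
      J.fst_part_def[symmetric])

lemma snd_psi_pure:
  assumes "a \<in> carrier A" "h \<in> carrier H"
  shows "AH'.snd_proj (\<psi> (a \<otimes>\<^bsub>A,H\<^esub> h)) = \<epsilon>\<^bsub>A\<^esub> a \<odot>\<^bsub>H'\<^esub> v h"
  using assms by (simp add: psi_pure snd_E'_mult rv_simps unit_simps J.snd_part_def[symmetric])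

text \<open>
  \<open>v\<close> is the map which \<open>\<psi>\<close> induces along \<open>\<epsilon> \<otimes> id\<close>.  The same computation for the inverse of \<open>\<psi>\<close>
  yields a map \<open>w\<close>, and since \<open>\<epsilon> \<otimes> id\<close> is surjective, \<open>v\<close> and \<open>w\<close> are mutually inverse.
\<close>

lemma snd_psi:
  assumes "t \<in> carrier (tensor A H)"
  shows "AH'.snd_proj (\<psi> t) = v (AH.snd_proj t)"
  by (rule tensor_unique[where X = H', OF A.vspace_C H.vspace_C H'.vspace_C _ _ _ assms])
    (simp_all add: rv_simps snd_psi_pure linear_map_scale[OF J.linear_snd_part])

abbreviation "\<phi> \<equiv> inv_into (carrier (tensor A H)) \<psi>"
definition w :: "'g \<Rightarrow> 'h" where "w g = AH.snd_proj (\<phi> (\<one>\<^bsub>A\<^esub> \<otimes>\<^bsub>A,H'\<^esub> g))"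

lemma linear_phi: "linear_map (tensor A H') (tensor A H) \<phi>"
  by (rule linear_map_inv[OF vspace_tensor linear_psi bij_psi])

lemma psi_phi: "t \<in> carrier (tensor A H') \<Longrightarrow> \<psi> (\<phi> t) = t"
  and phi_psi: "s \<in> carrier (tensor A H) \<Longrightarrow> \<phi> (\<psi> s) = s"
  using bij_psi by (auto simp: bij_betw_def f_inv_into_f)

lemmas phi_simps = rv_simps linear_phi linear_map_comp[OF linear_phi] linear_map_closed[OF linear_phi]

lemma linear_w: "linear_map H' H w"
  unfolding w_def[abs_def] by (simp add: phi_simps)

lemma phi_left:
  assumes "a \<in> carrier A" "t \<in> carrier (tensor A H')"
  shows "\<phi> ((a \<otimes>\<^bsub>A,H'\<^esub> \<one>\<^bsub>H'\<^esub>) \<cdot>\<^bsub>E'\<^esub> t) = (a \<otimes>\<^bsub>A,H\<^esub> \<one>\<^bsub>H\<^esub>) \<cdot>\<^bsub>E\<^esub> \<phi> t"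
  using psi_left[OF assms(1), of "\<phi> t"] phi_psi[of "(a \<otimes>\<^bsub>A,H\<^esub> \<one>\<^bsub>H\<^esub>) \<cdot>\<^bsub>E\<^esub> \<phi> t"] assms
  by (simp add: phi_simps psi_phi)

lemma snd_phi:
  assumes "t \<in> carrier (tensor A H')"
  shows "AH.snd_proj (\<phi> t) = w (AH'.snd_proj t)"
proof (rule tensor_unique[where X = H, OF A.vspace_C H'.vspace_C H.vspace_C _ _ _ assms])
  fix a g assume ag: "a \<in> carrier A" "g \<in> carrier H'"
  have "AH.snd_proj (\<phi> (a \<otimes>\<^bsub>A,H'\<^esub> g))
      = AH.snd_proj (\<phi> ((a \<otimes>\<^bsub>A,H'\<^esub> \<one>\<^bsub>H'\<^esub>) \<cdot>\<^bsub>E'\<^esub> (\<one>\<^bsub>A\<^esub> \<otimes>\<^bsub>A,H'\<^esub> g)))"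
    using ag by (simp add: E'_left_mult_pure unit_simps phi_simps)
  also have "\<dots> = \<epsilon>\<^bsub>A\<^esub> a \<odot>\<^bsub>H\<^esub> w g"
    using ag by (simp add: phi_left phi_simps snd_E_left_mult w_def del: E'_carrier)
  finally show "AH.snd_proj (\<phi> (a \<otimes>\<^bsub>A,H'\<^esub> g)) = w (AH'.snd_proj (a \<otimes>\<^bsub>A,H'\<^esub> g))"
    using ag by (simp add: phi_simps linear_map_scale[OF linear_w])
qed (simp_all add: phi_simps linear_map_comp[OF linear_w])

lemma v_w: "g \<in> carrier H' \<Longrightarrow> v (w g) = g"
  by (simp add: w_def snd_psi[symmetric] phi_simps psi_phi unit_simps)

lemma w_v: "h \<in> carrier H \<Longrightarrow> w (v h) = h"
  by (simp add: J.snd_part_def j_def snd_phi[symmetric] phi_simps phi_psi unit_simps)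

lemma j_mult:
  assumes "h \<in> carrier H" "g \<in> carrier H"
  shows "j (h \<cdot>\<^bsub>H\<^esub> g) = j h \<cdot>\<^bsub>E'\<^esub> j g"
proof -
  have "(\<one>\<^bsub>A\<^esub> \<otimes>\<^bsub>A,H\<^esub> h) \<cdot>\<^bsub>E\<^esub> (\<one>\<^bsub>A\<^esub> \<otimes>\<^bsub>A,H\<^esub> g) = \<one>\<^bsub>A\<^esub> \<otimes>\<^bsub>A,H\<^esub> (h \<cdot>\<^bsub>H\<^esub> g)"
    using assms by (simp add: E_mult_pure A.sw_one[where X = "tensor A H"] mult_simps unit_simps
        cong: coalgebra.sw_simp_cong)
  then show ?thesis
    using psi_mult[of "\<one>\<^bsub>A\<^esub> \<otimes>\<^bsub>A,H\<^esub> h" "\<one>\<^bsub>A\<^esub> \<otimes>\<^bsub>A,H\<^esub> g"] assms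
    by (simp add: j_def mult_simps)
qed

lemma v_mult: "h \<in> carrier H \<Longrightarrow> g \<in> carrier H \<Longrightarrow> v (h \<cdot>\<^bsub>H\<^esub> g) = v h \<cdot>\<^bsub>H'\<^esub> v g"
  by (simp add: J.snd_part_def j_mult snd_E'_mult J.j_closed)

lemma fst_j_mult:
  assumes "h \<in> carrier H" "y \<in> carrier (tensor A H')"
  shows "AH'.fst_proj (j h \<cdot>\<^bsub>E'\<^esub> y) = sw H h (\<lambda>h1 h2. r h1 \<cdot>\<^bsub>A\<^esub> (v h2 \<triangleright>' AH'.fst_proj y))"
proof -
  have bil: "bilinear_map A H' A (\<lambda>a g. a \<cdot>\<^bsub>A\<^esub> (g \<triangleright>' AH'.fst_proj y))"
    using assms by (simp add: rv_simps)
  show ?thesis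
    using assms J.j_fst_snd[OF assms(1)]
    by (simp add: fst_E'_mult J.j_closed rv_simps
        H.sw_linear[OF _ linear_map_tlift[OF A.vspace_C H'.vspace_C A.vspace_C bil]]
        tlift_pure[OF A.vspace_C H'.vspace_C A.vspace_C bil] cong: coalgebra.sw_simp_cong)
qed

lemma r_mult:
  assumes "h \<in> carrier H" "g \<in> carrier H"
  shows "r (h \<cdot>\<^bsub>H\<^esub> g) = sw H h (\<lambda>h1 h2. r h1 \<cdot>\<^bsub>A\<^esub> (v h2 \<triangleright>' r g))"
  using fst_j_mult[OF assms(1) J.j_closed[OF assms(2)]] assms
  by (simp add: J.fst_part_def j_mult)

text \<open>
  The two ways to compute \<open>\<psi>((1 \<bowtie> h)(a \<bowtie> 1))\<close>.  Its images under the two projections yield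
  \<open>ract_trivial\<close> and \<open>lact_intertwines\<close>.
\<close>

lemma psi_commutation:
  assumes "h \<in> carrier H" "a \<in> carrier A"
  shows "sw H h (\<lambda>h1 h2. sw A a (\<lambda>a1 a2. \<psi> ((h1 \<triangleright> a1) \<otimes>\<^bsub>A,H\<^esub> (h2 \<triangleleft> a2))))
    = j h \<cdot>\<^bsub>E'\<^esub> \<psi> (a \<otimes>\<^bsub>A,H\<^esub> \<one>\<^bsub>H\<^esub>)"
proof -
  have "sw H h (\<lambda>h1 h2. sw A a (\<lambda>a1 a2. \<psi> ((h1 \<triangleright> a1) \<otimes>\<^bsub>A,H\<^esub> (h2 \<triangleleft> a2))))
      = \<psi> ((\<one>\<^bsub>A\<^esub> \<otimes>\<^bsub>A,H\<^esub> h) \<cdot>\<^bsub>E\<^esub> (a \<otimes>\<^bsub>A,H\<^esub> \<one>\<^bsub>H\<^esub>))"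
    using assms by (simp add: E_mult_pure H.sw_linear[OF _ linear_psi] A.sw_linear[OF _ linear_psi]
        psi_simps unit_simps cong: coalgebra.sw_simp_cong)
  also have "\<dots> = j h \<cdot>\<^bsub>E'\<^esub> \<psi> (a \<otimes>\<^bsub>A,H\<^esub> \<one>\<^bsub>H\<^esub>)"
    using assms by (simp add: psi_mult psi_simps j_def)
  finally show ?thesis .
qed

lemma ract_trivial:
  assumes "h \<in> carrier H" "a \<in> carrier A"
  shows "h \<triangleleft> a = \<epsilon>\<^bsub>A\<^esub> a \<odot>\<^bsub>H\<^esub> h"
proof -
  have "v (h \<triangleleft> a) = sw H h (\<lambda>h1 h2. sw A a (\<lambda>a1 a2. \<epsilon>\<^bsub>A\<^esub> (h1 \<triangleright> a1) \<odot>\<^bsub>H'\<^esub> v (h2 \<triangleleft> a2)))"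
    using assms by (simp add: rv_simps unit_simps cong: coalgebra.sw_simp_cong)
  also have "\<dots> = AH'.snd_proj (sw H h (\<lambda>h1 h2. sw A a (\<lambda>a1 a2. \<psi> ((h1 \<triangleright> a1) \<otimes>\<^bsub>A,H\<^esub> (h2 \<triangleleft> a2)))))"
    using assms by (simp add: H.sw_linear[OF _ AH'.linear_snd_proj] A.sw_linear[OF _ AH'.linear_snd_proj]
        snd_psi_pure rv_simps cong: coalgebra.sw_simp_cong)
  also have "\<dots> = \<epsilon>\<^bsub>A\<^esub> a \<odot>\<^bsub>H'\<^esub> v h"
    using assms by (simp add: psi_commutation snd_E'_mult snd_psi_pure rv_simps v_one unit_simps
        J.snd_part_def[symmetric])
  finally have "w (v (h \<triangleleft> a)) = w (\<epsilon>\<^bsub>A\<^esub> a \<odot>\<^bsub>H'\<^esub> v h)" by simp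
  then show ?thesis using assms by (simp add: rv_simps w_v linear_map_scale[OF linear_w])
qed

lemma lact_intertwines:
  assumes "h \<in> carrier H" "a \<in> carrier A"
  shows "sw H h (\<lambda>x y. (x \<triangleright> a) \<cdot>\<^bsub>A\<^esub> r y) = sw H h (\<lambda>x y. r x \<cdot>\<^bsub>A\<^esub> (v y \<triangleright>' a))"
proof -
  have "sw H h (\<lambda>x y. (x \<triangleright> a) \<cdot>\<^bsub>A\<^esub> r y)
      = sw H h (\<lambda>x y. sw A a (\<lambda>a1 a2. (x \<triangleright> a1) \<cdot>\<^bsub>A\<^esub> r (y \<triangleleft> a2)))"
    using assms by (simp add: ract_trivial rv_simps linear_map_scale[OF J.linear_fst_part]
        cong: coalgebra.sw_simp_cong)
  also have "\<dots> = AH'.fst_proj (sw H h (\<lambda>x y. sw A a (\<lambda>a1 a2. \<psi> ((x \<triangleright> a1) \<otimes>\<^bsub>A,H\<^esub> (y \<triangleleft> a2)))))"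
    using assms by (simp add: H.sw_linear[OF _ AH'.linear_fst_proj] A.sw_linear[OF _ AH'.linear_fst_proj]
        fst_psi rv_simps cong: coalgebra.sw_simp_cong)
  also have "\<dots> = sw H h (\<lambda>x y. r x \<cdot>\<^bsub>A\<^esub> (v y \<triangleright>' a))"
    using assms by (simp add: psi_commutation fst_j_mult fst_psi r_one rv_simps unit_simps)
  finally show ?thesis .
qed

sublocale R: coalgebra_to_hopf H A r
  by unfold_locales (rule J.coalgebra_map_fst_part)

text \<open>
  Convolving \<open>lact_intertwines\<close> on the right with \<open>S\<^sub>A \<circ> r\<close> isolates \<open>h \<triangleright> a\<close>.
\<close>

lemma lact_formula:
  assumes "h \<in> carrier H" "a \<in> carrier A"
  shows "h \<triangleright> a = sw H h (\<lambda>h1 h'. sw H h' (\<lambda>h2 h3.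
    r h1 \<cdot>\<^bsub>A\<^esub> (v h2 \<triangleright>' a) \<cdot>\<^bsub>A\<^esub> antipode A (r h3)))"
proof -
  note s = R.r_simps rv_simps
  have "sw H h (\<lambda>h1 h'. sw H h' (\<lambda>h2 h3. r h1 \<cdot>\<^bsub>A\<^esub> (v h2 \<triangleright>' a) \<cdot>\<^bsub>A\<^esub> antipode A (r h3)))
      = sw H h (\<lambda>x y. sw H x (\<lambda>x1 x2. r x1 \<cdot>\<^bsub>A\<^esub> (v x2 \<triangleright>' a) \<cdot>\<^bsub>A\<^esub> antipode A (r y)))"
    by (rule H.sw_coassoc[where X = A, symmetric]) (use assms in \<open>simp_all add: s\<close>)
  also have "\<dots> = sw H h (\<lambda>x y. sw H x (\<lambda>x1 x2. r x1 \<cdot>\<^bsub>A\<^esub> (v x2 \<triangleright>' a)) \<cdot>\<^bsub>A\<^esub> antipode A (r y))"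
    using assms by (simp add: H.sw_linear[where X = A and Y = A and g = "\<lambda>z. z \<cdot>\<^bsub>A\<^esub> antipode A (r y)" for y] s
        cong: coalgebra.sw_simp_cong)
  also have "\<dots> = sw H h (\<lambda>x y. sw H x (\<lambda>x1 x2. (x1 \<triangleright> a) \<cdot>\<^bsub>A\<^esub> r x2) \<cdot>\<^bsub>A\<^esub> antipode A (r y))"
    using assms by (simp add: lact_intertwines H.coalgebra_axioms cong: coalgebra.sw_simp_cong)
  also have "\<dots> = h \<triangleright> a"
    by (rule R.convolution_cancel) (use assms in \<open>simp_all add: s R.antipode_r\<close>)
  finally show ?thesis by simp
qed

text \<open>
  Apply \<open>id \<otimes> w\<close> to \<open>r(h\<^sub>1) \<otimes> v(h\<^sub>2) = r(h\<^sub>2) \<otimes> v(h\<^sub>1)\<close>.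
\<close>

lemma r_cocentral: "cocentral H A r"
proof -
  have "sw H h (\<lambda>x y. r x \<otimes>\<^bsub>A,H\<^esub> y) = sw H h (\<lambda>x y. r y \<otimes>\<^bsub>A,H\<^esub> x)" if h: "h \<in> carrier H" for h
  proof -
    let ?q = "tlift A H' (\<lambda>a g. a \<otimes>\<^bsub>A,H\<^esub> w g)"
    note s = rv_simps linear_w linear_map_comp[OF linear_w] linear_map_closed[OF linear_w] w_v
    have bil: "bilinear_map A H' (tensor A H) (\<lambda>a g. a \<otimes>\<^bsub>A,H\<^esub> w g)" by (simp add: s)
    note q = H.sw_linear[OF _ linear_map_tlift[OF A.vspace_C H'.vspace_C vspace_tensor bil]]
      tlift_pure[OF A.vspace_C H'.vspace_C vspace_tensor bil]
    have "?q (sw H h (\<lambda>x y. r x \<otimes>\<^bsub>A,H'\<^esub> v y)) = ?q (sw H h (\<lambda>x y. r y \<otimes>\<^bsub>A,H'\<^esub> v x))"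
      using J.j_fst_snd[OF h] J.j_snd_fst[OF h] by simp
    then show ?thesis using h by (simp add: q s cong: coalgebra.sw_simp_cong)
  qed
  then show ?thesis by (simp add: cocentral_def J.coalgebra_map_fst_part sw_def[symmetric])
qed

lemma v_hopf_iso: "hopf_iso H H' v"
proof -
  have "bij_betw v (carrier H) (carrier H')"
    by (rule bij_betw_byWitness[where f' = w])
      (auto simp: v_w w_v linear_map_closed[OF linear_w] linear_map_closed[OF J.linear_snd_part])
  then show ?thesis
    by (simp add: hopf_iso_def hopf_hom_def algebra_map_def J.linear_snd_part v_mult v_one
        J.coalgebra_map_snd_part)
qed

end

section \<open>From the pair of maps to an isomorphism\<close>

locale bicrossed_smash_pair = bicrossed_and_smash A H H' lact ract lact'
  for A :: "('k::field, 'a::ab_group_add) bialgebra"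
    and H :: "('k, 'h::ab_group_add) bialgebra"
    and H' :: "('k, 'g::ab_group_add) bialgebra"
    and lact :: "'h \<Rightarrow> 'a \<Rightarrow> 'a"  (infixr "\<triangleright>" 80)
    and ract :: "'h \<Rightarrow> 'a \<Rightarrow> 'h"  (infixl "\<triangleleft>" 80)
    and lact' :: "'g \<Rightarrow> 'a \<Rightarrow> 'a"  (infixr "\<triangleright>''" 80) +
  fixes r :: "'h \<Rightarrow> 'a" and v :: "'h \<Rightarrow> 'g"
  assumes ract_trivial: "\<lbrakk>h \<in> carrier H; a \<in> carrier A\<rbrakk> \<Longrightarrow> h \<triangleleft> a = \<epsilon>\<^bsub>A\<^esub> a \<odot>\<^bsub>H\<^esub> h"
    and r_one: "r \<one>\<^bsub>H\<^esub> = \<one>\<^bsub>A\<^esub>"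
    and r_cocentral: "cocentral H A r"
    and v_iso: "hopf_iso H H' v"
    and lact_formula: "\<lbrakk>h \<in> carrier H; a \<in> carrier A\<rbrakk> \<Longrightarrow>
      h \<triangleright> a = sw H h (\<lambda>h1 h'. sw H h' (\<lambda>h2 h3.
        r h1 \<cdot>\<^bsub>A\<^esub> (v h2 \<triangleright>' a) \<cdot>\<^bsub>A\<^esub> antipode A (r h3)))"
    and r_mult: "\<lbrakk>h \<in> carrier H; g \<in> carrier H\<rbrakk> \<Longrightarrow>
      r (h \<cdot>\<^bsub>H\<^esub> g) = sw H h (\<lambda>h1 h2. r h1 \<cdot>\<^bsub>A\<^esub> (v h2 \<triangleright>' r g))"
begin

sublocale R: coalgebra_to_hopf H A r
  by unfold_locales (use r_cocentral in \<open>simp add: cocentral_def\<close>)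

lemma v_coalgebra_map: "coalgebra_map H H' v"
  using v_iso by (simp add: hopf_iso_def hopf_hom_def)

lemma linear_v: "linear_map H H' v"
  using v_coalgebra_map by (simp add: coalgebra_map_def)

lemma counit_v: "h \<in> carrier H \<Longrightarrow> \<epsilon>\<^bsub>H'\<^esub> (v h) = \<epsilon>\<^bsub>H\<^esub> h"
  using v_coalgebra_map by (simp add: coalgebra_map_def)

lemma v_one: "v \<one>\<^bsub>H\<^esub> = \<one>\<^bsub>H'\<^esub>"
  using v_iso by (simp add: hopf_iso_def hopf_hom_def algebra_map_def)

lemma v_mult: "h \<in> carrier H \<Longrightarrow> g \<in> carrier H \<Longrightarrow> v (h \<cdot>\<^bsub>H\<^esub> g) = v h \<cdot>\<^bsub>H'\<^esub> v g"
  using v_iso by (simp add: hopf_iso_def hopf_hom_def algebra_map_def)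

lemma bij_v: "bij_betw v (carrier H) (carrier H')"
  using v_iso by (simp add: hopf_iso_def)

abbreviation "w \<equiv> inv_into (carrier H) v"

lemma linear_w: "linear_map H' H w"
  by (rule linear_map_inv[OF H.vspace_C linear_v bij_v])

lemma v_w: "g \<in> carrier H' \<Longrightarrow> v (w g) = g"
  and w_v: "h \<in> carrier H \<Longrightarrow> w (v h) = h"
  using bij_v by (auto simp: bij_betw_def f_inv_into_f)

lemmas rv_simps = R.r_simps mult_simps counit_v
  linear_v linear_map_comp[OF linear_v] linear_map_closed[OF linear_v]
  linear_w linear_map_comp[OF linear_w] linear_map_closed[OF linear_w]

lemmas sw_v = sw_coalgebra_map[OF H.coalgebra_axioms H'.coalgebra_axioms v_coalgebra_map]

lemma sw_cocentral:
  assumes "bilinear_map A H X f" "vspace X" "h \<in> carrier H"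
  shows "sw H h (\<lambda>x y. f (r x) y) = sw H h (\<lambda>x y. f (r y) x)"
proof -
  note q = H.sw_linear[OF _ linear_map_tlift[OF A.vspace_C H.vspace_C assms(2,1)]]
    tlift_pure[OF A.vspace_C H.vspace_C assms(2,1)]
  have "tlift A H f (sw H h (\<lambda>x y. r x \<otimes>\<^bsub>A,H\<^esub> y)) = tlift A H f (sw H h (\<lambda>x y. r y \<otimes>\<^bsub>A,H\<^esub> x))"
    using r_cocentral assms(3) by (simp add: cocentral_def sw_def)
  then show ?thesis using assms(2-) by (simp add: q rv_simps del: bilinear_map_iff cong: coalgebra.sw_simp_cong)
qed

definition \<psi> :: "('k, 'a, 'h) tensor \<Rightarrow> ('k, 'a, 'g) tensor" where
  "\<psi> = tlift A H (\<lambda>a h. sw H h (\<lambda>x y. (a \<cdot>\<^bsub>A\<^esub> r x) \<otimes>\<^bsub>A,H'\<^esub> v y))"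

text \<open>
  Right convolution by \<open>r\<close> in the first tensor factor is undone by right convolution by
  \<open>S\<^sub>A \<circ> r\<close>; this is the inverse of \<open>\<psi>\<close>.
\<close>

definition \<phi> :: "('k, 'a, 'g) tensor \<Rightarrow> ('k, 'a, 'h) tensor" where
  "\<phi> = tlift A H' (\<lambda>a g. sw H (w g) (\<lambda>x y. (a \<cdot>\<^bsub>A\<^esub> antipode A (r x)) \<otimes>\<^bsub>A,H\<^esub> y))"

lemma linear_psi: "linear_map (tensor A H) (tensor A H') \<psi>"
  unfolding \<psi>_def by (rule linear_map_tlift) (simp_all add: rv_simps)

lemma linear_phi: "linear_map (tensor A H') (tensor A H) \<phi>"
  unfolding \<phi>_def by (rule linear_map_tlift) (simp_all add: rv_simps)

lemma psi_pure:
  assumes "a \<in> carrier A" "h \<in> carrier H"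
  shows "\<psi> (a \<otimes>\<^bsub>A,H\<^esub> h) = sw H h (\<lambda>x y. (a \<cdot>\<^bsub>A\<^esub> r x) \<otimes>\<^bsub>A,H'\<^esub> v y)"
  unfolding \<psi>_def using assms by (simp add: tlift_pure[where X = "tensor A H'"] rv_simps)

lemma phi_pure:
  assumes "a \<in> carrier A" "g \<in> carrier H'"
  shows "\<phi> (a \<otimes>\<^bsub>A,H'\<^esub> g) = sw H (w g) (\<lambda>x y. (a \<cdot>\<^bsub>A\<^esub> antipode A (r x)) \<otimes>\<^bsub>A,H\<^esub> y)"
  unfolding \<phi>_def using assms by (simp add: tlift_pure[where X = "tensor A H"] rv_simps)

lemmas psi_simps = rv_simps linear_psi linear_map_comp[OF linear_psi] linear_map_closed[OF linear_psi]
  linear_phi linear_map_comp[OF linear_phi] linear_map_closed[OF linear_phi]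

text \<open>
  Used with \<open>(P, Q) = (r, S \<circ> r)\<close> and \<open>(S \<circ> r, r)\<close>, for the two composites of \<open>\<psi>\<close> and \<open>\<phi>\<close>.
\<close>

lemma sw_cancel:
  assumes P: "linear_map H A P" and Q: "linear_map H A Q"
    and PQ: "\<And>h. h \<in> carrier H \<Longrightarrow> sw H h (\<lambda>x y. P x \<cdot>\<^bsub>A\<^esub> Q y) = \<epsilon>\<^bsub>H\<^esub> h \<odot>\<^bsub>A\<^esub> \<one>\<^bsub>A\<^esub>"
    and f: "linear_map H V f" and V: "vspace V" and a: "a \<in> carrier A" and h: "h \<in> carrier H"
  shows "sw H h (\<lambda>x y. sw H y (\<lambda>y1 y2. (a \<cdot>\<^bsub>A\<^esub> P x \<cdot>\<^bsub>A\<^esub> Q y1) \<otimes>\<^bsub>A,V\<^esub> f y2)) = a \<otimes>\<^bsub>A,V\<^esub> f h"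
proof -
  note s = rv_simps V a P Q f linear_map_closed[OF P] linear_map_closed[OF Q] linear_map_closed[OF f]
    linear_map_comp[OF P] linear_map_comp[OF Q] linear_map_comp[OF f]
  have "sw H h (\<lambda>x y. sw H y (\<lambda>y1 y2. (a \<cdot>\<^bsub>A\<^esub> P x \<cdot>\<^bsub>A\<^esub> Q y1) \<otimes>\<^bsub>A,V\<^esub> f y2))
      = sw H h (\<lambda>x y. sw H x (\<lambda>x1 x2. (a \<cdot>\<^bsub>A\<^esub> P x1 \<cdot>\<^bsub>A\<^esub> Q x2) \<otimes>\<^bsub>A,V\<^esub> f y))"
    by (rule H.sw_coassoc[where X = "tensor A V", symmetric]) (use h in \<open>simp_all add: s\<close>)
  also have "\<dots> = sw H h (\<lambda>x y. (a \<cdot>\<^bsub>A\<^esub> sw H x (\<lambda>x1 x2. P x1 \<cdot>\<^bsub>A\<^esub> Q x2)) \<otimes>\<^bsub>A,V\<^esub> f y)"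
    using h by (simp add: s A.mult_assoc
        H.sw_linear[where X = A and Y = "tensor A V" and g = "\<lambda>z. (a \<cdot>\<^bsub>A\<^esub> z) \<otimes>\<^bsub>A,V\<^esub> f y" for y]
        cong: coalgebra.sw_simp_cong)
  also have "\<dots> = a \<otimes>\<^bsub>A,V\<^esub> f h"
    using h by (simp add: PQ s A.mult_one cong: coalgebra.sw_simp_cong)
  finally show ?thesis .
qed

lemma phi_psi:
  assumes "t \<in> carrier (tensor A H)"
  shows "\<phi> (\<psi> t) = t"
proof (rule tensor_unique[OF A.vspace_C H.vspace_C vspace_tensor _ linear_map_id _ assms])
  fix a h assume ah: "a \<in> carrier A" "h \<in> carrier H"
  have "\<phi> (\<psi> (a \<otimes>\<^bsub>A,H\<^esub> h)) = sw H h (\<lambda>x y. sw H y (\<lambda>y1 y2.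
      (a \<cdot>\<^bsub>A\<^esub> r x \<cdot>\<^bsub>A\<^esub> antipode A (r y1)) \<otimes>\<^bsub>A,H\<^esub> y2))"
    using ah by (simp add: psi_pure phi_pure psi_simps w_v H.sw_linear[OF _ linear_phi] cong: coalgebra.sw_simp_cong)
  also have "\<dots> = a \<otimes>\<^bsub>A,H\<^esub> h"
    by (rule sw_cancel) (use ah in \<open>simp_all add: psi_simps R.antipode_r\<close>)
  finally show "\<phi> (\<psi> (a \<otimes>\<^bsub>A,H\<^esub> h)) = a \<otimes>\<^bsub>A,H\<^esub> h" .
qed (simp add: psi_simps)

lemma psi_phi:
  assumes "t \<in> carrier (tensor A H')"
  shows "\<psi> (\<phi> t) = t"
proof (rule tensor_unique[OF A.vspace_C H'.vspace_C vspace_tensor _ linear_map_id _ assms])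
  fix a g assume ag: "a \<in> carrier A" "g \<in> carrier H'"
  have "\<psi> (\<phi> (a \<otimes>\<^bsub>A,H'\<^esub> g)) = sw H (w g) (\<lambda>x y. sw H y (\<lambda>y1 y2.
      (a \<cdot>\<^bsub>A\<^esub> antipode A (r x) \<cdot>\<^bsub>A\<^esub> r y1) \<otimes>\<^bsub>A,H'\<^esub> v y2))"
    using ag by (simp add: psi_pure phi_pure psi_simps H.sw_linear[OF _ linear_psi] cong: coalgebra.sw_simp_cong)
  also have "\<dots> = a \<otimes>\<^bsub>A,H'\<^esub> v (w g)"
    by (rule sw_cancel) (use ag in \<open>simp_all add: psi_simps R.antipode_r\<close>)
  finally show "\<psi> (\<phi> (a \<otimes>\<^bsub>A,H'\<^esub> g)) = a \<otimes>\<^bsub>A,H'\<^esub> g" using ag by (simp add: v_w)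
qed (simp add: psi_simps)

lemma bij_psi: "bij_betw \<psi> (carrier (tensor A H)) (carrier (tensor A H'))"
  by (rule bij_betw_byWitness[where f' = \<phi>])
    (auto simp: phi_psi psi_phi linear_map_closed[OF linear_psi] linear_map_closed[OF linear_phi])

lemma psi_one: "\<psi> (\<one>\<^bsub>A\<^esub> \<otimes>\<^bsub>A,H\<^esub> \<one>\<^bsub>H\<^esub>) = \<one>\<^bsub>A\<^esub> \<otimes>\<^bsub>A,H'\<^esub> \<one>\<^bsub>H'\<^esub>"
  by (simp add: psi_pure psi_simps H.sw_one[where X = "tensor A H'"] r_one v_one unit_simps)

lemma psi_left:
  assumes "a \<in> carrier A" "t \<in> carrier (tensor A H)"
  shows "\<psi> ((a \<otimes>\<^bsub>A,H\<^esub> \<one>\<^bsub>H\<^esub>) \<cdot>\<^bsub>E\<^esub> t) = (a \<otimes>\<^bsub>A,H'\<^esub> \<one>\<^bsub>H'\<^esub>) \<cdot>\<^bsub>E'\<^esub> \<psi> t"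
  by (rule tensor_unique[where X = "tensor A H'", OF A.vspace_C H.vspace_C vspace_tensor _ _ _ assms(2)])
    (simp_all add: psi_simps assms(1) E_left_mult_pure E'_left_mult_pure psi_pure A.mult_assoc
      H.sw_linear[where X = "tensor A H'" and Y = "tensor A H'" and g = "\<lambda>z. (a \<otimes>\<^bsub>A,H'\<^esub> \<one>\<^bsub>H'\<^esub>) \<cdot>\<^bsub>E'\<^esub> z"]
      cong: coalgebra.sw_simp_cong)

lemma psi_counit:
  assumes "t \<in> carrier (tensor A H)"
  shows "tensor_counit A H' (\<psi> t) = tensor_counit A H t"
proof (rule tensor_unique[OF A.vspace_C H.vspace_C vspace_ground _ AH.linear_tensor_counit _ assms])
  show "linear_map (tensor A H) ground (\<lambda>t. tensor_counit A H' (\<psi> t))"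
    by (rule linear_map_comp[OF AH'.linear_tensor_counit linear_psi])
  fix a h assume ah: "a \<in> carrier A" "h \<in> carrier H"
  have "\<epsilon>\<^bsub>H\<^esub> h = sw H h (\<lambda>x y. \<epsilon>\<^bsub>H\<^esub> x * \<epsilon>\<^bsub>H\<^esub> y)"
    using H.sw_counit_left[of ground "\<epsilon>\<^bsub>H\<^esub>" h] ah by (simp add: H.linear_counit vspace_ground)
  moreover have "\<epsilon>\<^bsub>A\<^esub> a * sw H h (\<lambda>x y. \<epsilon>\<^bsub>H\<^esub> x * \<epsilon>\<^bsub>H\<^esub> y) = sw H h (\<lambda>x y. \<epsilon>\<^bsub>A\<^esub> a * (\<epsilon>\<^bsub>H\<^esub> x * \<epsilon>\<^bsub>H\<^esub> y))"
    using H.sw_scale_right[of ground h "\<lambda>x y. \<epsilon>\<^bsub>H\<^esub> x * \<epsilon>\<^bsub>H\<^esub> y" "\<epsilon>\<^bsub>A\<^esub> a"] ah by (simp add: vspace_ground)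
  ultimately show "tensor_counit A H' (\<psi> (a \<otimes>\<^bsub>A,H\<^esub> h)) = tensor_counit A H (a \<otimes>\<^bsub>A,H\<^esub> h)"
    using ah by (simp add: psi_pure H.sw_linear[OF _ AH'.linear_tensor_counit] AH.tensor_counit_pure
        AH'.tensor_counit_pure psi_simps A.counit_mult mult.assoc cong: coalgebra.sw_simp_cong)
qed

text \<open>
  On a pure tensor one side is \<open>(a\<^sub>1 r(h\<^sub>1) # v(h\<^sub>3)) \<otimes> (a\<^sub>2 r(h\<^sub>2) # v(h\<^sub>4))\<close> and the other is
  \<open>(a\<^sub>1 r(h\<^sub>1) # v(h\<^sub>2)) \<otimes> (a\<^sub>2 r(h\<^sub>3) # v(h\<^sub>4))\<close>: they differ by an exchange of \<open>h\<^sub>2\<close> and \<open>h\<^sub>3\<close>,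
  one of which sits under \<open>r\<close>.
\<close>

lemma psi_comult:
  assumes "t \<in> carrier (tensor A H)"
  shows "tensor_comult A H' (\<psi> t) = tlift (tensor A H) (tensor A H)
    (\<lambda>x y. \<psi> x \<otimes>\<^bsub>tensor A H',tensor A H'\<^esub> \<psi> y) (tensor_comult A H t)"
proof (rule AH.tlift_comult_ext[symmetric, OF _ _ _ _ assms])
  let ?T' = "tensor A H'"
  let ?X = "tensor ?T' ?T'"
  show "linear_map (tensor A H) ?X (\<lambda>t. tensor_comult A H' (\<psi> t))"
    by (rule linear_map_comp[OF AH'.linear_tensor_comult linear_psi])
  fix a h assume ah: "a \<in> carrier A" "h \<in> carrier H"
  have "tensor_comult A H' (\<psi> (a \<otimes>\<^bsub>A,H\<^esub> h)) = sw H h (\<lambda>x y. tensor_comult A H' ((a \<cdot>\<^bsub>A\<^esub> r x) \<otimes>\<^bsub>A,H'\<^esub> v y))"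
    using ah by (simp add: psi_pure H.sw_linear[OF _ AH'.linear_tensor_comult] psi_simps)
  also have "\<dots> = sw H h (\<lambda>x y. sw A a (\<lambda>a1 a2. sw H x (\<lambda>x1 x2. sw H y (\<lambda>y1 y2.
      ((a1 \<cdot>\<^bsub>A\<^esub> r x1) \<otimes>\<^bsub>A,H'\<^esub> v y1) \<otimes>\<^bsub>?T',?T'\<^esub> ((a2 \<cdot>\<^bsub>A\<^esub> r x2) \<otimes>\<^bsub>A,H'\<^esub> v y2)))))"
    using ah by (simp add: AH'.tensor_comult_pure psi_simps A.sw_mult[where X = ?X]
        R.sw_r[where X = ?X] sw_v[where X = ?X] cong: coalgebra.sw_simp_cong)
  also have "\<dots> = sw A a (\<lambda>a1 a2. sw H h (\<lambda>x y. sw H x (\<lambda>x1 x2. sw H y (\<lambda>y1 y2.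
      ((a1 \<cdot>\<^bsub>A\<^esub> r x1) \<otimes>\<^bsub>A,H'\<^esub> v y1) \<otimes>\<^bsub>?T',?T'\<^esub> ((a2 \<cdot>\<^bsub>A\<^esub> r x2) \<otimes>\<^bsub>A,H'\<^esub> v y2)))))"
    by (rule sw_swap)
  also have "\<dots> = sw A a (\<lambda>a1 a2. sw H h (\<lambda>x y. sw H x (\<lambda>x1 x2. sw H y (\<lambda>y1 y2.
      ((a1 \<cdot>\<^bsub>A\<^esub> r x1) \<otimes>\<^bsub>A,H'\<^esub> v x2) \<otimes>\<^bsub>?T',?T'\<^esub> ((a2 \<cdot>\<^bsub>A\<^esub> r y1) \<otimes>\<^bsub>A,H'\<^esub> v y2)))))"
  proof (rule A.sw_cong[OF ah(1)])
    fix a1 a2 assume a: "a1 \<in> carrier A" "a2 \<in> carrier A"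
    \<comment> \<open>Cocentrality concerns the slots \<open>b\<close> and \<open>s\<close>, and \<open>r\<close> is applied to the argument for \<open>b\<close>.\<close>
    let ?F = "\<lambda>p b s q. ((a1 \<cdot>\<^bsub>A\<^esub> r p) \<otimes>\<^bsub>A,H'\<^esub> v s) \<otimes>\<^bsub>?T',?T'\<^esub> ((a2 \<cdot>\<^bsub>A\<^esub> b) \<otimes>\<^bsub>A,H'\<^esub> v q)"
    have "sw H h (\<lambda>x y. sw H x (\<lambda>x1 x2. sw H y (\<lambda>y1 y2. ?F x1 (r x2) y1 y2)))
        = sw H h (\<lambda>x y. sw H y (\<lambda>p q. sw H p (\<lambda>p1 p2. ?F x (r p1) p2 q)))"
      by (rule H.sw_middle[where X = ?X]) (use ah a in \<open>simp_all add: psi_simps\<close>)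
    also have "\<dots> = sw H h (\<lambda>x y. sw H y (\<lambda>p q. sw H p (\<lambda>p1 p2. ?F x (r p2) p1 q)))"
      by (intro H.sw_cong sw_cocentral[where X = ?X]) (use ah a in \<open>simp_all add: psi_simps\<close>)
    also have "\<dots> = sw H h (\<lambda>x y. sw H x (\<lambda>x1 x2. sw H y (\<lambda>y1 y2. ?F x1 (r y1) x2 y2)))"
      by (rule H.sw_middle[where X = ?X, symmetric]) (use ah a in \<open>simp_all add: psi_simps\<close>)
    finally show "sw H h (\<lambda>x y. sw H x (\<lambda>x1 x2. sw H y (\<lambda>y1 y2. ?F x1 (r x2) y1 y2)))
        = sw H h (\<lambda>x y. sw H x (\<lambda>x1 x2. sw H y (\<lambda>y1 y2. ?F x1 (r y1) x2 y2)))" .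
  qed
  also have "\<dots> = sw A a (\<lambda>a1 a2. sw H h (\<lambda>x y. sw H y (\<lambda>y1 y2. sw H x (\<lambda>x1 x2.
      ((a1 \<cdot>\<^bsub>A\<^esub> r x1) \<otimes>\<^bsub>A,H'\<^esub> v x2) \<otimes>\<^bsub>?T',?T'\<^esub> ((a2 \<cdot>\<^bsub>A\<^esub> r y1) \<otimes>\<^bsub>A,H'\<^esub> v y2)))))"
    by (intro A.sw_cong[OF ah(1)] H.sw_cong[OF ah(2)] sw_swap)
  also have "\<dots> = sw A a (\<lambda>a1 a2. sw H h (\<lambda>x y.
      \<psi> (a1 \<otimes>\<^bsub>A,H\<^esub> x) \<otimes>\<^bsub>?T',?T'\<^esub> \<psi> (a2 \<otimes>\<^bsub>A,H\<^esub> y)))"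
    using ah by (simp add: psi_pure psi_simps
        H.sw_linear[where X = ?T' and Y = ?X and g = "\<lambda>z. u \<otimes>\<^bsub>?T',?T'\<^esub> z" for u]
        H.sw_linear[where X = ?T' and Y = ?X and g = "\<lambda>z. z \<otimes>\<^bsub>?T',?T'\<^esub> u" for u]
        cong: coalgebra.sw_simp_cong)
  finally show "sw A a (\<lambda>a1 a2. sw H h (\<lambda>x y.
      \<psi> (a1 \<otimes>\<^bsub>A,H\<^esub> x) \<otimes>\<^bsub>?T',?T'\<^esub> \<psi> (a2 \<otimes>\<^bsub>A,H\<^esub> y))) = tensor_comult A H' (\<psi> (a \<otimes>\<^bsub>A,H\<^esub> h))"
    by simp
qed (simp_all add: psi_simps)

text \<open>
  The formula for \<open>\<triangleright>\<close> says \<open>(- \<triangleright> c) = L * (S \<circ> r)\<close> with \<open>L h = r(h\<^sub>1)(v(h\<^sub>2) \<triangleright>' c)\<close>; convolving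
  with \<open>r\<close> removes the antipode.
\<close>

lemma lact_intertwines:
  assumes "h \<in> carrier H" "c \<in> carrier A"
  shows "sw H h (\<lambda>x y. (x \<triangleright> c) \<cdot>\<^bsub>A\<^esub> r y) = sw H h (\<lambda>x y. r x \<cdot>\<^bsub>A\<^esub> (v y \<triangleright>' c))"
proof -
  let ?L = "\<lambda>h. sw H h (\<lambda>x y. r x \<cdot>\<^bsub>A\<^esub> (v y \<triangleright>' c))"
  have "x \<triangleright> c = sw H x (\<lambda>u z. ?L u \<cdot>\<^bsub>A\<^esub> antipode A (r z))" if x: "x \<in> carrier H" for x
  proof -
    have "sw H x (\<lambda>u z. ?L u \<cdot>\<^bsub>A\<^esub> antipode A (r z))
        = sw H x (\<lambda>u z. sw H u (\<lambda>u1 u2. r u1 \<cdot>\<^bsub>A\<^esub> (v u2 \<triangleright>' c) \<cdot>\<^bsub>A\<^esub> antipode A (r z)))"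
      using x assms by (simp add: psi_simps
          H.sw_linear[where X = A and Y = A and g = "\<lambda>y. y \<cdot>\<^bsub>A\<^esub> antipode A (r z)" for z]
          cong: coalgebra.sw_simp_cong)
    also have "\<dots> = x \<triangleright> c"
      unfolding lact_formula[OF x assms(2)]
      by (rule H.sw_coassoc[where X = A]) (use x assms in \<open>simp_all add: psi_simps\<close>)
    finally show ?thesis by simp
  qed
  then have "sw H h (\<lambda>x y. (x \<triangleright> c) \<cdot>\<^bsub>A\<^esub> r y)
      = sw H h (\<lambda>x y. sw H x (\<lambda>u z. ?L u \<cdot>\<^bsub>A\<^esub> antipode A (r z)) \<cdot>\<^bsub>A\<^esub> r y)"
    using assms by (simp add: H.coalgebra_axioms cong: coalgebra.sw_simp_cong)
  also have "\<dots> = ?L h"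
    by (rule R.convolution_cancel) (use assms in \<open>simp_all add: psi_simps R.antipode_r\<close>)
  finally show ?thesis .
qed

text \<open>
  \<open>(h\<^sub>1 \<triangleright> c) r(h\<^sub>2 g) = (h\<^sub>1 \<triangleright> c) r(h\<^sub>2)(v(h\<^sub>3) \<triangleright>' r(g)) = r(h\<^sub>1)(v(h\<^sub>2) \<triangleright>' c)(v(h\<^sub>3) \<triangleright>' r(g))\<close>, and
  the last two factors combine since \<open>A\<close> is a module algebra.
\<close>

lemma lact_mult_r:
  assumes "h \<in> carrier H" "g \<in> carrier H" "c \<in> carrier A"
  shows "sw H h (\<lambda>x y. (x \<triangleright> c) \<cdot>\<^bsub>A\<^esub> r (y \<cdot>\<^bsub>H\<^esub> g))
    = sw H h (\<lambda>x y. r x \<cdot>\<^bsub>A\<^esub> (v y \<triangleright>' (c \<cdot>\<^bsub>A\<^esub> r g)))"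
proof -
  have "sw H h (\<lambda>x y. (x \<triangleright> c) \<cdot>\<^bsub>A\<^esub> r (y \<cdot>\<^bsub>H\<^esub> g))
      = sw H h (\<lambda>x y. sw H y (\<lambda>y1 y2. (x \<triangleright> c) \<cdot>\<^bsub>A\<^esub> r y1 \<cdot>\<^bsub>A\<^esub> (v y2 \<triangleright>' r g)))"
    using assms by (simp add: psi_simps r_mult A.mult_assoc
        H.sw_linear[where X = A and Y = A and g = "\<lambda>z. (x \<triangleright> c) \<cdot>\<^bsub>A\<^esub> z" for x] cong: coalgebra.sw_simp_cong)
  also have "\<dots> = sw H h (\<lambda>x y. sw H x (\<lambda>x1 x2. (x1 \<triangleright> c) \<cdot>\<^bsub>A\<^esub> r x2 \<cdot>\<^bsub>A\<^esub> (v y \<triangleright>' r g)))"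
    by (rule H.sw_coassoc[where X = A, symmetric]) (use assms in \<open>simp_all add: psi_simps\<close>)
  also have "\<dots> = sw H h (\<lambda>x y. sw H x (\<lambda>x1 x2. (x1 \<triangleright> c) \<cdot>\<^bsub>A\<^esub> r x2) \<cdot>\<^bsub>A\<^esub> (v y \<triangleright>' r g))"
    using assms by (simp add: psi_simps
        H.sw_linear[where X = A and Y = A and g = "\<lambda>z. z \<cdot>\<^bsub>A\<^esub> (v y \<triangleright>' r g)" for y] cong: coalgebra.sw_simp_cong)
  also have "\<dots> = sw H h (\<lambda>x y. sw H x (\<lambda>x1 x2. r x1 \<cdot>\<^bsub>A\<^esub> (v x2 \<triangleright>' c)) \<cdot>\<^bsub>A\<^esub> (v y \<triangleright>' r g))"
    using assms by (simp add: lact_intertwines H.coalgebra_axioms cong: coalgebra.sw_simp_cong)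
  also have "\<dots> = sw H h (\<lambda>x y. sw H x (\<lambda>x1 x2. r x1 \<cdot>\<^bsub>A\<^esub> ((v x2 \<triangleright>' c) \<cdot>\<^bsub>A\<^esub> (v y \<triangleright>' r g))))"
    using assms by (simp add: psi_simps A.mult_assoc
        H.sw_linear[where X = A and Y = A and g = "\<lambda>z. z \<cdot>\<^bsub>A\<^esub> (v y \<triangleright>' r g)" for y] cong: coalgebra.sw_simp_cong)
  also have "\<dots> = sw H h (\<lambda>x y. sw H y (\<lambda>y1 y2. r x \<cdot>\<^bsub>A\<^esub> ((v y1 \<triangleright>' c) \<cdot>\<^bsub>A\<^esub> (v y2 \<triangleright>' r g))))"
    by (rule H.sw_coassoc[where X = A]) (use assms in \<open>simp_all add: psi_simps\<close>)
  also have "\<dots> = sw H h (\<lambda>x y. r x \<cdot>\<^bsub>A\<^esub> (v y \<triangleright>' (c \<cdot>\<^bsub>A\<^esub> r g)))"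
    using assms by (simp add: psi_simps lact'_mult sw_v[where X = A]
        H.sw_linear[where X = A and Y = A and g = "\<lambda>z. r x \<cdot>\<^bsub>A\<^esub> z" for x] cong: coalgebra.sw_simp_cong)
  finally show ?thesis .
qed

lemma E_mult_pure_trivial:
  assumes "a \<in> carrier A" "c \<in> carrier A" "h \<in> carrier H" "g \<in> carrier H"
  shows "(a \<otimes>\<^bsub>A,H\<^esub> h) \<cdot>\<^bsub>E\<^esub> (c \<otimes>\<^bsub>A,H\<^esub> g)
    = sw H h (\<lambda>x y. (a \<cdot>\<^bsub>A\<^esub> (x \<triangleright> c)) \<otimes>\<^bsub>A,H\<^esub> (y \<cdot>\<^bsub>H\<^esub> g))"
  using assms by (simp add: E_mult_pure ract_trivial psi_simps cong: coalgebra.sw_simp_cong)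

text \<open>
  The left-hand side is \<open>a (h\<^sub>1 \<triangleright> c) r(h\<^sub>2 g\<^sub>1) # v(h\<^sub>3 g\<^sub>2)\<close>.  The proof regroups the sums until
  \<open>lact_mult_r\<close> applies to \<open>h\<^sub>1 \<otimes> h\<^sub>2\<close> with \<open>g\<^sub>1\<close> in place of \<open>g\<close>, and then restores the grouping.
\<close>

lemma psi_mult_pure:
  assumes a: "a \<in> carrier A" and c: "c \<in> carrier A" and h: "h \<in> carrier H" and g: "g \<in> carrier H"
  shows "\<psi> ((a \<otimes>\<^bsub>A,H\<^esub> h) \<cdot>\<^bsub>E\<^esub> (c \<otimes>\<^bsub>A,H\<^esub> g)) = \<psi> (a \<otimes>\<^bsub>A,H\<^esub> h) \<cdot>\<^bsub>E'\<^esub> \<psi> (c \<otimes>\<^bsub>A,H\<^esub> g)"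
proof -
  let ?T' = "tensor A H'"
  note s = psi_simps a c h g
  have "\<psi> ((a \<otimes>\<^bsub>A,H\<^esub> h) \<cdot>\<^bsub>E\<^esub> (c \<otimes>\<^bsub>A,H\<^esub> g))
      = sw H h (\<lambda>x y. sw H y (\<lambda>y1 y2. sw H g (\<lambda>g1 g2.
          (a \<cdot>\<^bsub>A\<^esub> ((x \<triangleright> c) \<cdot>\<^bsub>A\<^esub> r (y1 \<cdot>\<^bsub>H\<^esub> g1))) \<otimes>\<^bsub>A,H'\<^esub> v (y2 \<cdot>\<^bsub>H\<^esub> g2))))"
    by (simp add: s E_mult_pure_trivial H.sw_linear[OF _ linear_psi] psi_pure A.mult_assoc
        H.sw_mult[where X = ?T'] cong: coalgebra.sw_simp_cong)
  also have "\<dots> = sw H h (\<lambda>x y. sw H x (\<lambda>x1 x2. sw H g (\<lambda>g1 g2.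
          (a \<cdot>\<^bsub>A\<^esub> ((x1 \<triangleright> c) \<cdot>\<^bsub>A\<^esub> r (x2 \<cdot>\<^bsub>H\<^esub> g1))) \<otimes>\<^bsub>A,H'\<^esub> v (y \<cdot>\<^bsub>H\<^esub> g2))))"
    by (rule H.sw_coassoc[where X = ?T', symmetric]) (simp_all add: s)
  also have "\<dots> = sw H h (\<lambda>x y. sw H g (\<lambda>g1 g2. sw H x (\<lambda>x1 x2.
          (a \<cdot>\<^bsub>A\<^esub> ((x1 \<triangleright> c) \<cdot>\<^bsub>A\<^esub> r (x2 \<cdot>\<^bsub>H\<^esub> g1))) \<otimes>\<^bsub>A,H'\<^esub> v (y \<cdot>\<^bsub>H\<^esub> g2))))"
    by (intro H.sw_cong[OF h] sw_swap)
  also have "\<dots> = sw H h (\<lambda>x y. sw H g (\<lambda>g1 g2.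
          (a \<cdot>\<^bsub>A\<^esub> sw H x (\<lambda>x1 x2. (x1 \<triangleright> c) \<cdot>\<^bsub>A\<^esub> r (x2 \<cdot>\<^bsub>H\<^esub> g1))) \<otimes>\<^bsub>A,H'\<^esub> v (y \<cdot>\<^bsub>H\<^esub> g2)))"
    by (simp add: s H.sw_linear[where X = A and Y = ?T' and g = "\<lambda>z. (a \<cdot>\<^bsub>A\<^esub> z) \<otimes>\<^bsub>A,H'\<^esub> u" for u]
        cong: coalgebra.sw_simp_cong)
  also have "\<dots> = sw H h (\<lambda>x y. sw H g (\<lambda>g1 g2.
          (a \<cdot>\<^bsub>A\<^esub> sw H x (\<lambda>x1 x2. r x1 \<cdot>\<^bsub>A\<^esub> (v x2 \<triangleright>' (c \<cdot>\<^bsub>A\<^esub> r g1)))) \<otimes>\<^bsub>A,H'\<^esub> v (y \<cdot>\<^bsub>H\<^esub> g2)))"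
    by (simp add: s lact_mult_r cong: coalgebra.sw_simp_cong)
  also have "\<dots> = sw H h (\<lambda>x y. sw H g (\<lambda>g1 g2. sw H x (\<lambda>x1 x2.
          (a \<cdot>\<^bsub>A\<^esub> (r x1 \<cdot>\<^bsub>A\<^esub> (v x2 \<triangleright>' (c \<cdot>\<^bsub>A\<^esub> r g1)))) \<otimes>\<^bsub>A,H'\<^esub> v (y \<cdot>\<^bsub>H\<^esub> g2))))"
    by (simp add: s H.sw_linear[where X = A and Y = ?T' and g = "\<lambda>z. (a \<cdot>\<^bsub>A\<^esub> z) \<otimes>\<^bsub>A,H'\<^esub> u" for u]
        cong: coalgebra.sw_simp_cong)
  also have "\<dots> = sw H h (\<lambda>x y. sw H x (\<lambda>x1 x2. sw H g (\<lambda>g1 g2.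
          (a \<cdot>\<^bsub>A\<^esub> (r x1 \<cdot>\<^bsub>A\<^esub> (v x2 \<triangleright>' (c \<cdot>\<^bsub>A\<^esub> r g1)))) \<otimes>\<^bsub>A,H'\<^esub> v (y \<cdot>\<^bsub>H\<^esub> g2))))"
    by (intro H.sw_cong[OF h] sw_swap)
  also have "\<dots> = sw H h (\<lambda>x y. sw H y (\<lambda>y1 y2. sw H g (\<lambda>g1 g2.
          (a \<cdot>\<^bsub>A\<^esub> (r x \<cdot>\<^bsub>A\<^esub> (v y1 \<triangleright>' (c \<cdot>\<^bsub>A\<^esub> r g1)))) \<otimes>\<^bsub>A,H'\<^esub> v (y2 \<cdot>\<^bsub>H\<^esub> g2))))"
    by (rule H.sw_coassoc[where X = ?T']) (simp_all add: s)
  also have "\<dots> = sw H h (\<lambda>x y. sw H g (\<lambda>g1 g2. sw H y (\<lambda>y1 y2.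
          (a \<cdot>\<^bsub>A\<^esub> (r x \<cdot>\<^bsub>A\<^esub> (v y1 \<triangleright>' (c \<cdot>\<^bsub>A\<^esub> r g1)))) \<otimes>\<^bsub>A,H'\<^esub> v (y2 \<cdot>\<^bsub>H\<^esub> g2))))"
    by (intro H.sw_cong[OF h] sw_swap)
  also have "\<dots> = sw H h (\<lambda>x y. sw H g (\<lambda>g1 g2.
          ((a \<cdot>\<^bsub>A\<^esub> r x) \<otimes>\<^bsub>A,H'\<^esub> v y) \<cdot>\<^bsub>E'\<^esub> ((c \<cdot>\<^bsub>A\<^esub> r g1) \<otimes>\<^bsub>A,H'\<^esub> v g2)))"
    by (simp add: s E'_mult_pure sw_v[where X = ?T'] v_mult A.mult_assoc cong: coalgebra.sw_simp_cong)
  also have "\<dots> = sw H g (\<lambda>g1 g2. sw H h (\<lambda>x y.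
          ((a \<cdot>\<^bsub>A\<^esub> r x) \<otimes>\<^bsub>A,H'\<^esub> v y) \<cdot>\<^bsub>E'\<^esub> ((c \<cdot>\<^bsub>A\<^esub> r g1) \<otimes>\<^bsub>A,H'\<^esub> v g2)))"
    by (rule sw_swap)
  also have "\<dots> = \<psi> (a \<otimes>\<^bsub>A,H\<^esub> h) \<cdot>\<^bsub>E'\<^esub> \<psi> (c \<otimes>\<^bsub>A,H\<^esub> g)"
    by (simp add: s psi_pure
        H.sw_linear[where X = ?T' and Y = ?T' and g = "\<lambda>z. u \<cdot>\<^bsub>E'\<^esub> z" for u]
        H.sw_linear[where X = ?T' and Y = ?T' and g = "\<lambda>z. z \<cdot>\<^bsub>E'\<^esub> u" for u]
        cong: coalgebra.sw_simp_cong)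
  finally show ?thesis .
qed

lemma psi_mult:
  assumes "x \<in> carrier (tensor A H)" "y \<in> carrier (tensor A H)"
  shows "\<psi> (x \<cdot>\<^bsub>E\<^esub> y) = \<psi> x \<cdot>\<^bsub>E'\<^esub> \<psi> y"
proof (rule tensor_unique[where X = "tensor A H'", OF A.vspace_C H.vspace_C vspace_tensor _ _ _ assms(1)])
  fix a h assume ah: "a \<in> carrier A" "h \<in> carrier H"
  show "\<psi> ((a \<otimes>\<^bsub>A,H\<^esub> h) \<cdot>\<^bsub>E\<^esub> y) = \<psi> (a \<otimes>\<^bsub>A,H\<^esub> h) \<cdot>\<^bsub>E'\<^esub> \<psi> y"
    by (rule tensor_unique[where X = "tensor A H'", OF A.vspace_C H.vspace_C vspace_tensor _ _ _ assms(2)])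
      (simp_all add: psi_simps ah psi_mult_pure)
qed (simp_all add: psi_simps assms)

lemma psi_hopf_iso: "hopf_iso E E' \<psi>"
proof -
  have "algebra_map E E' \<psi>"
    by (simp add: algebra_map_def linear_map_E_E' linear_psi psi_mult psi_one)
  moreover have "coalgebra_map E E' \<psi>"
    using psi_comult by (simp add: coalgebra_map_def linear_map_E_E' linear_psi psi_counit sweedler_def
        tlift_def pure_tensor_same[OF same_E'] tensor_rep_same[OF same_E])
  ultimately show ?thesis by (simp add: hopf_iso_def hopf_hom_def bij_psi)
qed

lemma psi_left_linear: "left_linear A H H' E E' \<psi>"
  by (simp add: left_linear_def linear_map_E_E' linear_psi psi_left)

end


section \<open>The equivalence\<close>

theorem corollary3p10:
  fixes A :: "('k::field, 'a::ab_group_add) bialgebra"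
    and H :: "('k, 'h::ab_group_add) bialgebra"
    and H' :: "('k, 'g::ab_group_add) bialgebra"
    and lact :: "'h \<Rightarrow> 'a \<Rightarrow> 'a"  (infixr "\<triangleright>" 80)
    and ract :: "'h \<Rightarrow> 'a \<Rightarrow> 'h"  (infixl "\<triangleleft>" 80)
    and lact' :: "'g \<Rightarrow> 'a \<Rightarrow> 'a"  (infixr "\<triangleright>''" 80)
  assumes "matched_pair A H (\<triangleright>) (\<triangleleft>)"
    and "hopf_algebra H'"
    and "left_module_algebra H' A (\<triangleright>')"
    and "left_module_coalgebra H' A (\<triangleright>')"
    and "\<And>g a. \<lbrakk>g \<in> carrier H'; a \<in> carrier A\<rbrakk> \<Longrightarrow>
      (\<Sum>(g1, g2)\<leftarrow>sweedler H' g. g1 \<otimes>\<^bsub>H',A\<^esub> (g2 \<triangleright>' a)) =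
      (\<Sum>(g1, g2)\<leftarrow>sweedler H' g. g2 \<otimes>\<^bsub>H',A\<^esub> (g1 \<triangleright>' a))"
  shows
    "(\<exists>\<psi>. hopf_iso (bicrossed_product A H (\<triangleright>) (\<triangleleft>)) (smash_product A H' (\<triangleright>')) \<psi> \<and>
          left_linear A H H' (bicrossed_product A H (\<triangleright>) (\<triangleleft>)) (smash_product A H' (\<triangleright>')) \<psi>)
     \<longleftrightarrow>
     (trivial_right_action A H (\<triangleleft>) \<and>
      (\<exists>r v. unitary H A r \<and> cocentral H A r \<and> hopf_iso H H' v \<and>
        (\<forall>h\<in>carrier H. \<forall>a\<in>carrier A.
           h \<triangleright> a =
           (\<Sum>(h1, h')\<leftarrow>sweedler H h. \<Sum>(h2, h3)\<leftarrow>sweedler H h'.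
              r h1 \<cdot>\<^bsub>A\<^esub> (v h2 \<triangleright>' a) \<cdot>\<^bsub>A\<^esub> antipode A (r h3))) \<and>
        (\<forall>h\<in>carrier H. \<forall>g\<in>carrier H.
           r (h \<cdot>\<^bsub>H\<^esub> g) =
           (\<Sum>(h1, h2)\<leftarrow>sweedler H h. r h1 \<cdot>\<^bsub>A\<^esub> (v h2 \<triangleright>' r g)))))"
    (is "?lhs \<longleftrightarrow> ?rhs")
proof
  interpret bicrossed_and_smash A H H' lact ract lact'
    using assms(1-4) by (intro bicrossed_and_smash.intro bicrossed_and_smash_axioms.intro)
  note sw = sw_def[symmetric]
  {
    assume ?lhs
    then obtain \<psi> where "hopf_iso E E' \<psi>" "left_linear A H H' E E' \<psi>" by blast
    then interpret bicrossed_smash_iso A H H' lact ract lact' \<psi> by unfold_locales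
    show ?rhs
      unfolding trivial_right_action_def unitary_def sw
      using ract_trivial r_one r_cocentral v_hopf_iso lact_formula r_mult by blast
  next
    assume ?rhs
    then obtain r v where "trivial_right_action A H (\<triangleleft>)" "r \<one>\<^bsub>H\<^esub> = \<one>\<^bsub>A\<^esub>" "cocentral H A r" "hopf_iso H H' v"
      "\<forall>h\<in>carrier H. \<forall>a\<in>carrier A. h \<triangleright> a = sw H h (\<lambda>h1 h'. sw H h' (\<lambda>h2 h3.
         r h1 \<cdot>\<^bsub>A\<^esub> (v h2 \<triangleright>' a) \<cdot>\<^bsub>A\<^esub> antipode A (r h3)))"
      "\<forall>h\<in>carrier H. \<forall>g\<in>carrier H. r (h \<cdot>\<^bsub>H\<^esub> g) = sw H h (\<lambda>h1 h2. r h1 \<cdot>\<^bsub>A\<^esub> (v h2 \<triangleright>' r g))"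
      unfolding unitary_def sw by blast
    then have "bicrossed_smash_pair A H H' lact ract lact' r v"
      unfolding trivial_right_action_def by unfold_locales blast+
    then interpret bicrossed_smash_pair A H H' lact ract lact' r v .
    show ?lhs using psi_hopf_iso psi_left_linear by blast
  }
qed

end
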